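(* Let $\mathcal{X}$ and $\mathcal{Y}$ be infinite-dimensional Banach spaces over $\mathbb{F}\in\{\mathbb{R},\mathbb{C}\}$, and let $\mathcal{A}\subseteq\mathcal{B}(\mathcal{X})$ and $\mathcal{B}\subseteq\mathcal{B}(\mathcal{Y})$ be standard operator algebras. Let $\phi:\mathcal{A}\to\mathcal{B}$ be a bijective map. Then the following statements are equivalent: (1) $\phi$ is completely quadratic preserving in both directions, i.e. for every $n\in\mathbb{N}$ and every $T\in \mathcal{A}\otimes M_n$, $T$ is quadratic if and only if $\phi_n(T)$ is quadratic. (2) $\phi$ is 2-quadratic preserving in both directions, i.e. for every $T\in\mathcal{A}\otimes M_2$, $T$ is quadratic if and only if $\phi_2(T)$ is quadratic. (3) There exist a bounded invertible linear or (in the complex case) conjugate-linear operator $A:\mathcal{X}\to\mathcal{Y}$ and a scalar $\lambda$ such that $\phi(T)=\lambda ATA^{-1}$ for all $T\in\mathcal{A}$.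
   Context: $\mathcal{B}(\mathcal{X})$ denotes the algebra of bounded linear operators on $\mathcal{X}$. A standard operator algebra on $\mathcal{X}$ is a norm-closed subalgebra of $\mathcal{B}(\mathcal{X})$ containing the identity $I$ and all finite-rank operators. An operator $T$ (on a Banach space, or an $n\times n$ operator matrix viewed as an operator on $\mathcal{X}^n$) is quadratic if there exist scalars $a,b$ with $(T-aI)(T-bI)=0$. For a map $\phi:\mathcal{A}\to\mathcal{B}$ and $n\in\mathbb{N}$, $\phi_n:\mathcal{A}\otimes M_n\to\mathcal{B}\otimes M_n$ is defined by $\phi_n((a_{ij})_{n\times n})=(\phi(a_{ij}))_{n\times n}$, where $\mathcal{A}\otimes M_n$ denotes $n\times n$ matrices with entries in $\mathcal{A}$, acting on $\mathcal{X}^n$. *)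

theory Defs
  imports "HOL-Analysis.Analysis"
begin

text \<open>Scalar field conventions.  A Banach space over F (F = real or complex) is modelled as a
real Banach space (type class banach) together with a complex structure J (used only when
F = complex): J is bounded real-linear, J (J x) = - x and the norm is invariant under
multiplication by unimodular scalars.  Complex scalar multiplication is
c . x = Re c *R x + Im c *R J x.  The scalar field itself is a set F of complex numbers,
either the reals or all of the complex numbers.\<close>

definition complex_structure :: "('a::real_normed_vector \<Rightarrow> 'a) \<Rightarrow> bool" where
  "complex_structure J \<longleftrightarrow> bounded_linear J \<and> (\<forall>x. J (J x) = - x) \<and>
     (\<forall>x t. norm (cos t *\<^sub>R x + sin t *\<^sub>R J x) = norm x)"

definition csmul :: "('a::real_vector \<Rightarrow> 'a) \<Rightarrow> complex \<Rightarrow> 'a \<Rightarrow> 'a" where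
  "csmul J c x = Re c *\<^sub>R x + Im c *\<^sub>R J x"

definition scalar_setting :: "complex set \<Rightarrow> ('a::banach \<Rightarrow> 'a) \<Rightarrow> ('b::banach \<Rightarrow> 'b) \<Rightarrow> bool" where
  "scalar_setting F JX JY \<longleftrightarrow>
     F = \<real> \<or> (F = UNIV \<and> complex_structure JX \<and> complex_structure JY)"

text \<open>Infinite-dimensional (over the reals; equivalently over the complex numbers).\<close>
definition infinite_dimensional :: "'a::real_vector itself \<Rightarrow> bool" where
  "infinite_dimensional _ \<longleftrightarrow> \<not> (\<exists>S::'a set. finite S \<and> span S = UNIV)"

definition F_linear :: "complex set \<Rightarrow> ('a::real_vector \<Rightarrow> 'a) \<Rightarrow> ('b::real_vector \<Rightarrow> 'b) \<Rightarrow> ('a \<Rightarrow> 'b) \<Rightarrow> bool" where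
  "F_linear F JX JY f \<longleftrightarrow> (\<forall>c\<in>F. \<forall>x. f (csmul JX c x) = csmul JY c (f x))"

definition F_conj_linear :: "complex set \<Rightarrow> ('a::real_vector \<Rightarrow> 'a) \<Rightarrow> ('b::real_vector \<Rightarrow> 'b) \<Rightarrow> ('a \<Rightarrow> 'b) \<Rightarrow> bool" where
  "F_conj_linear F JX JY f \<longleftrightarrow> (\<forall>c\<in>F. \<forall>x. f (csmul JX c x) = csmul JY (cnj c) (f x))"

definition bounded_ops :: "complex set \<Rightarrow> ('a::banach \<Rightarrow> 'a) \<Rightarrow> ('a \<Rightarrow>\<^sub>L 'a) set" where
  "bounded_ops F J = {T. F_linear F J J (blinfun_apply T)}"

definition csmulL :: "('a::real_normed_vector \<Rightarrow> 'a) \<Rightarrow> complex \<Rightarrow> ('b::real_normed_vector \<Rightarrow>\<^sub>L 'a) \<Rightarrow> ('b \<Rightarrow>\<^sub>L 'a)" where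
  "csmulL J c T = Re c *\<^sub>R T + Im c *\<^sub>R (Blinfun J o\<^sub>L T)"

definition finite_rank :: "('a::real_normed_vector \<Rightarrow>\<^sub>L 'a) \<Rightarrow> bool" where
  "finite_rank T \<longleftrightarrow> (\<exists>S. finite S \<and> range (blinfun_apply T) \<subseteq> span S)"

definition standard_operator_algebra :: "complex set \<Rightarrow> ('a::banach \<Rightarrow> 'a) \<Rightarrow> ('a \<Rightarrow>\<^sub>L 'a) set \<Rightarrow> bool" where
  "standard_operator_algebra F J \<A> \<longleftrightarrow>
     \<A> \<subseteq> bounded_ops F J \<and>
     (\<forall>S\<in>\<A>. \<forall>T\<in>\<A>. S + T \<in> \<A>) \<and>
     (\<forall>S\<in>\<A>. \<forall>T\<in>\<A>. S o\<^sub>L T \<in> \<A>) \<and>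
     (\<forall>c\<in>F. \<forall>T\<in>\<A>. csmulL J c T \<in> \<A>) \<and>
     closed \<A> \<and>
     id_blinfun \<in> \<A> \<and>
     (\<forall>T\<in>bounded_ops F J. finite_rank T \<longrightarrow> T \<in> \<A>)"

text \<open>An n x n operator matrix (entries indexed by i, j < n) is quadratic, as an operator on
X^n, if (T - aI)(T - bI) = 0 for some scalars a, b in F; the matrix product is written out
entrywise.\<close>
definition quadratic_matrix :: "complex set \<Rightarrow> ('a::banach \<Rightarrow> 'a) \<Rightarrow> nat \<Rightarrow> (nat \<Rightarrow> nat \<Rightarrow> ('a \<Rightarrow>\<^sub>L 'a)) \<Rightarrow> bool" where
  "quadratic_matrix F J n T \<longleftrightarrow>
     (\<exists>a\<in>F. \<exists>b\<in>F. \<forall>i<n. \<forall>j<n.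
        (\<Sum>k<n. (T i k - (if i = k then csmulL J a id_blinfun else 0)) o\<^sub>L
                 (T k j - (if k = j then csmulL J b id_blinfun else 0))) = 0)"

definition matrices_over :: "nat \<Rightarrow> 'x set \<Rightarrow> (nat \<Rightarrow> nat \<Rightarrow> 'x) set" where
  "matrices_over n \<A> = {T. \<forall>i<n. \<forall>j<n. T i j \<in> \<A>}"

definition amplify :: "('x \<Rightarrow> 'y) \<Rightarrow> (nat \<Rightarrow> nat \<Rightarrow> 'x) \<Rightarrow> (nat \<Rightarrow> nat \<Rightarrow> 'y)" where
  "amplify \<phi> T = (\<lambda>i j. \<phi> (T i j))"

end

theory Submission
  imports Defs
begin

text \<open>
  A matrix with rows \<open>A, B\<close> and \<open>C, D\<close> is quadratic iff for some \<open>p = a + b\<close> and \<open>q = - a b\<close> one has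
  \<open>A\<^sup>2 + BC = pA + q\<close>, \<open>AB + BD = pB\<close>, \<open>CA + DC = pC\<close> and \<open>CB + D\<^sup>2 = pD + q\<close>. Choosing the entries suitably, one
  expresses through this relation that an operator is a scalar, that it is an idempotent \<open>P\<close>, that \<open>PT = T\<close>,
  \<open>TP = T\<close> or \<open>TP = 0\<close>, and that \<open>c\<close> is an eigenvalue of a rank-one operator. So \<open>\<phi>\<close>, scaled to be unital,
  preserves all of this, and a rank-one matrix then yields \<open>\<phi> (x \<otimes> f) = \<tau> x \<otimes> \<sigma> f\<close> with
  \<open>\<sigma> f (\<tau> x) = h (f x)\<close> for a bijection \<open>h\<close> of the scalar field. Testing \<open>\<tau> (c x)\<close> and \<open>\<tau> (x + y)\<close> against
  functionals shows that \<open>h\<close> is a field automorphism and \<open>\<tau>\<close> is \<open>h\<close>-semilinear. Since the space is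
  infinite-dimensional, \<open>h\<close> is bounded near 0, hence it is the identity or the conjugation, and \<open>\<tau>\<close> is
  bounded because it is weakly bounded. Finally a square-zero matrix with entry \<open>T\<close> and three rank-one entries
  gives \<open>\<phi> T \<tau> = \<tau> T\<close>.
\<close>

section \<open>Norming functionals and weakly bounded linear maps\<close>

text \<open>Homogeneity is an inequality because that form is what infima inherit; applied to
  \<open>inverse c\<close> it becomes an equality.\<close>

definition sublinear :: "('a::real_vector \<Rightarrow> real) \<Rightarrow> bool" where
  "sublinear p \<longleftrightarrow> (\<forall>x y. p (x + y) \<le> p x + p y) \<and> (\<forall>c>0. \<forall>x. p (c *\<^sub>R x) \<le> c * p x)"

lemma sublinearD:
  assumes "sublinear p"
  shows sublinear_add: "p (x + y) \<le> p x + p y"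
    and sublinear_scaleR: "c > 0 \<Longrightarrow> p (c *\<^sub>R x) = c * p x"
    and sublinear_0: "p 0 = 0"
    and sublinear_minus: "- p (- x) \<le> p x"
proof -
  show add: "p (x + y) \<le> p x + p y" for x y
    using assms by (simp add: sublinear_def)
  have le: "p (c *\<^sub>R x) \<le> c * p x" if "c > 0" for c x
    using assms that by (simp add: sublinear_def)
  show "p (c *\<^sub>R x) = c * p x" if "c > 0" for c x
  proof (rule antisym[OF le[OF that]])
    have "p (inverse c *\<^sub>R c *\<^sub>R x) \<le> inverse c * p (c *\<^sub>R x)"
      using that by (intro le) simp
    then show "c * p x \<le> p (c *\<^sub>R x)"
      using that by (simp add: field_simps)
  qed
  \<comment> \<open>The factors 2 and 1/2 bound \<open>p 0\<close> by 0 from below and from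
    above.\<close>
  show p0: "p 0 = 0"
    using le[of 2 0] le[of "1/2" 0] by simp
  show "- p (- x) \<le> p x" for x
    using add[of x "- x"] p0 by simp
qed

text \<open>\<open>tilt p y\<close> is a sublinear minorant of \<open>p\<close>; a minimal \<open>p\<close> agrees with it for every \<open>y\<close>, hence is additive.
  Tilting the norm in the direction \<open>y\<close> first makes every linear minorant norming for \<open>y\<close>.\<close>

definition tilt :: "('a::real_vector \<Rightarrow> real) \<Rightarrow> 'a \<Rightarrow> 'a \<Rightarrow> real" where
  "tilt p y x = (INF t\<in>{0..}. p (x + t *\<^sub>R y) - t * p y)"

lemma tilt_le:
  assumes p: "sublinear p" and "t \<ge> 0"
  shows "tilt p y x \<le> p (x + t *\<^sub>R y) - t * p y"
  unfolding tilt_def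
proof (rule cINF_lower)
  \<comment> \<open>From \<open>t * p y = p (t *\<^sub>R y) \<le> p (x + t *\<^sub>R y) + p (-
    x)\<close>; the infimum is thus over a set bounded below.\<close>
  have "- p (- x) \<le> p (x + t *\<^sub>R y) - t * p y" if "t \<ge> 0" for t
  proof (cases "t = 0")
    case True
    then show ?thesis using sublinear_minus[OF p] by simp
  next
    case False
    then have "p (t *\<^sub>R y) = t * p y" using that p by (simp add: sublinear_scaleR)
    then show ?thesis using sublinear_add[OF p, of "x + t *\<^sub>R y" "- x"] by simp
  qed
  then show "bdd_below ((\<lambda>t. p (x + t *\<^sub>R y) - t * p y) ` {0..})"
    by (intro bdd_belowI2) auto
qed (use assms in auto)

text \<open>Parameters \<open>s\<close> for \<open>x\<close> and \<open>t\<close> for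
  \<open>x'\<close> combine to the parameter \<open>s + t\<close> for \<open>x + x'\<close>, and
  scaling \<open>x\<close> by \<open>c\<close> scales the parameter by \<open>c\<close>; both
  estimates then pass to the infima.\<close>

lemma sublinear_tilt:
  assumes p: "sublinear p"
  shows "sublinear (tilt p y)"
  unfolding sublinear_def
proof (intro conjI allI impI)
  fix x x'
  have *: "tilt p y (x + x') \<le> (p (x + s *\<^sub>R y) - s * p y) + (p (x' + t *\<^sub>R y) - t * p y)"
    if "s \<ge> 0" "t \<ge> 0" for s t
    using tilt_le[OF p, of "s + t" y "x + x'"] sublinear_add[OF p, of "x + s *\<^sub>R y" "x' + t *\<^sub>R y"] that
    by (simp add: algebra_simps)
  have "tilt p y (x + x') - (p (x + s *\<^sub>R y) - s * p y) \<le> tilt p y x'" if "s \<ge> 0" for s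
    unfolding tilt_def[of p y x'] using *[OF that] by (intro cINF_greatest) (auto simp: algebra_simps)
  then have "tilt p y (x + x') - tilt p y x' \<le> tilt p y x"
    unfolding tilt_def[of p y x] by (intro cINF_greatest) (auto simp: algebra_simps)
  then show "tilt p y (x + x') \<le> tilt p y x + tilt p y x'" by simp
next
  fix c :: real and x assume c: "c > 0"
  have "tilt p y (c *\<^sub>R x) / c \<le> p (x + t *\<^sub>R y) - t * p y" if "t \<ge> 0" for t
  proof -
    have "tilt p y (c *\<^sub>R x) \<le> p (c *\<^sub>R (x + t *\<^sub>R y)) - (c * t) * p y"
      using tilt_le[OF p, of "c * t" y "c *\<^sub>R x"] that c by (simp add: algebra_simps)
    also have "\<dots> = (p (x + t *\<^sub>R y) - t * p y) * c"
      unfolding sublinear_scaleR[OF p c] by (simp add: left_diff_distrib)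
    finally show ?thesis using c by (simp add: pos_divide_le_eq)
  qed
  then have "tilt p y (c *\<^sub>R x) / c \<le> tilt p y x"
    unfolding tilt_def[of p y x] by (intro cINF_greatest) auto
  then show "tilt p y (c *\<^sub>R x) \<le> c * tilt p y x" using c by (simp add: field_simps)
qed

lemma minimal_sublinear_linear:
  assumes p: "sublinear p" and min: "\<And>q. sublinear q \<Longrightarrow> q \<le> p \<Longrightarrow> q = p"
  shows "linear p"
proof -
  have "tilt p y = p" for y
  proof (rule min[OF sublinear_tilt[OF p]])
    show "tilt p y \<le> p" using tilt_le[OF p, of 0 y] by (simp add: le_fun_def)
  qed
  \<comment> \<open>At \<open>t = 1\<close> the equation \<open>tilt p y = p\<close> becomes
    superadditivity.\<close>
  then have "p x + p y \<le> p (x + y)" for x y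
    using tilt_le[OF p, of 1 y x] by simp
  then have add: "p (x + y) = p x + p y" for x y
    using sublinear_add[OF p] by (simp add: order_antisym)
  have neg: "p (- x) = - p x" for x
    using add[of x "- x"] sublinear_0[OF p] by simp
  show ?thesis
  proof (rule linearI[OF add])
    fix c x show "p (c *\<^sub>R x) = c *\<^sub>R p x"
      using sublinear_scaleR[OF p, of c x] sublinear_scaleR[OF p, of "- c" x] sublinear_0[OF p] neg[of "c *\<^sub>R x"]
      by (cases c "0 :: real" rule: linorder_cases) auto
  qed
qed

text \<open>Hahn-Banach in sublinear form: Zorn's lemma yields a minimal sublinear function below
  \<open>p\<close>, and minimality makes it linear.\<close>

lemma sublinear_linear_minorant:
  fixes p :: "'a::real_vector \<Rightarrow> real"
  assumes p: "sublinear p"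
  obtains f where "linear f" "f \<le> p"
proof -
  define S where "S = {q. sublinear q \<and> q \<le> p}"
  \<comment> \<open>The order is reversed, so that the maximal element from Zorn's lemma is a
    minimal function.\<close>
  let ?P = "\<lambda>q r :: 'a \<Rightarrow> real. r \<le> q"
  have "\<exists>m\<in>S. \<forall>q\<in>S. ?P m q \<longrightarrow> q = m"
  proof (rule predicate_Zorn)
    show "partial_order_on S (relation_of ?P S)"
      by (rule partial_order_on_relation_ofI) auto
  next
    fix C assume C: "C \<in> Chains (relation_of ?P S)"
    then have tot: "q \<le> r \<or> r \<le> q" if "q \<in> C" "r \<in> C" for q r
      using that by (auto simp: Chains_def relation_of_def)
    have CS: "q \<in> S" if "q \<in> C" for q
      using C that by (auto simp: Chains_def relation_of_def)
    show "\<exists>u\<in>S. \<forall>q\<in>C. ?P q u"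
    proof (cases "C = {}")
      case True
      then show ?thesis using p by (auto simp: S_def)
    next
      case False
      \<comment> \<open>The bound of a chain is its pointwise infimum; it is subadditive because any
        two members of the chain have a common lower one.\<close>
      define u where "u x = (INF q\<in>C. q x)" for x
      have bdd: "bdd_below ((\<lambda>q. q x) ` C)" for x
      proof (rule bdd_belowI2)
        fix q assume "q \<in> C"
        then have q: "sublinear q" "q (- x) \<le> p (- x)"
          using CS by (auto simp: S_def le_fun_def)
        then show "- p (- x) \<le> q x"
          using sublinear_minus[OF q(1), of x] by simp
      qed
      have low: "u x \<le> q x" if "q \<in> C" for x q
        unfolding u_def using that by (rule cINF_lower[OF bdd])
      have "sublinear u"
        unfolding sublinear_def
      proof (intro conjI allI impI)
        fix x y
        have *: "u (x + y) \<le> q x + r y" if qr: "q \<in> C" "r \<in> C" for q r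
        proof -
          obtain s where s: "s \<in> C" "s \<le> q" "s \<le> r" using tot[OF qr] qr by blast
          then have "s (x + y) \<le> s x + s y" using CS by (auto simp: S_def sublinear_add)
          also have "\<dots> \<le> q x + r y" using s by (intro add_mono) (auto simp: le_fun_def)
          finally show ?thesis using low[OF s(1), of "x + y"] by simp
        qed
        have "u (x + y) - q x \<le> u y" if "q \<in> C" for q
          unfolding u_def[of y] using *[OF that] False by (intro cINF_greatest) (auto simp: algebra_simps)
        then have "u (x + y) - u y \<le> u x"
          unfolding u_def[of x] using False by (intro cINF_greatest) (auto simp: algebra_simps)
        then show "u (x + y) \<le> u x + u y" by simp
      next
        fix c :: real and x assume c: "c > 0"
        have "u (c *\<^sub>R x) / c \<le> q x" if "q \<in> C" for q
          using low[OF that, of "c *\<^sub>R x"] CS[OF that] c by (simp add: S_def sublinear_scaleR field_simps)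
        then have "u (c *\<^sub>R x) / c \<le> u x"
          unfolding u_def[of x] using False by (intro cINF_greatest) auto
        then show "u (c *\<^sub>R x) \<le> c * u x" using c by (simp add: field_simps)
      qed
      moreover have "u \<le> p"
        using low False CS by (fastforce simp: S_def le_fun_def intro: order_trans)
      ultimately show ?thesis using low by (auto simp: S_def le_fun_def)
    qed
  qed
  then obtain m where m: "sublinear m" "m \<le> p" "\<And>q. sublinear q \<Longrightarrow> q \<le> m \<Longrightarrow> q = m"
    unfolding S_def using order_trans by blast
  then show ?thesis using that minimal_sublinear_linear by blast
qed

lemma norming_functional:
  fixes y :: "'a::real_normed_vector"
  obtains g :: "'a \<Rightarrow> real" where "bounded_linear g" "g y = norm y" "\<And>x. \<bar>g x\<bar> \<le> norm x"
proof -
  have sub: "sublinear (norm :: 'a \<Rightarrow> real)"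
    by (simp add: sublinear_def norm_triangle_ineq)
  obtain g where g: "linear g" "g \<le> tilt norm y"
    using sublinear_linear_minorant[OF sublinear_tilt[OF sub]] by blast
  have le: "g x \<le> norm (x + t *\<^sub>R y) - t * norm y" if "t \<ge> 0" for x t
    using tilt_le[OF sub that, of y x] g(2) by (meson le_funD order_trans)
  have "g x \<le> norm x" for x using le[of 0 x] by simp
  moreover have "- g x \<le> norm x" for x
    using le[of 0 "- x"] linear_neg[OF g(1), of x] by simp
  ultimately have bd: "\<bar>g x\<bar> \<le> norm x" for x by (simp add: abs_le_iff)
  \<comment> \<open>Parameter 1 at \<open>- y\<close> gives
    \<open>g (- y) \<le> norm (- y + y) - norm y = - norm y\<close>.\<close>
  moreover have "norm y \<le> g y"
    using le[of 1 "- y"] linear_neg[OF g(1), of y] by simp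
  with bd[of y] have "g y = norm y" by simp
  moreover have "bounded_linear g"
    using g(1) bd by (intro bounded_linear_intro[where K = 1]) (auto simp: linear_add linear_scale)
  ultimately show ?thesis using that by blast
qed

text \<open>Gliding hump: each vector of an absolutely convergent series is chosen so small for the earlier norming
  functionals, and with an image so large, that the image of the sum cannot have finite norm.\<close>

lemma weakly_bounded_linear_imp_bounded:
  fixes \<tau> :: "'a::banach \<Rightarrow> 'b::real_normed_vector"
  assumes lin: "linear \<tau>"
    and weak: "\<And>g :: 'b \<Rightarrow> real. bounded_linear g \<Longrightarrow> bounded_linear (\<lambda>x. g (\<tau> x))"
  shows "bounded_linear \<tau>"
proof (rule ccontr)
  assume unb: "\<not> bounded_linear \<tau>"
  \<comment> \<open>Were the values on one ball bounded, rescaling would bound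
    \<open>\<tau>\<close>.\<close>
  have big: "\<exists>x. norm x \<le> \<delta> \<and> R \<le> norm (\<tau> x)" if "\<delta> > 0" "R > 0" for \<delta> R
  proof (rule ccontr)
    assume neg: "\<nexists>x. norm x \<le> \<delta> \<and> R \<le> norm (\<tau> x)"
    have "norm (\<tau> x) \<le> norm x * (R / \<delta>)" for x
    proof (cases "x = 0")
      case False
      have "norm ((\<delta> / norm x) *\<^sub>R x) \<le> \<delta>" using that False by simp
      then have "norm (\<tau> ((\<delta> / norm x) *\<^sub>R x)) < R" using neg not_less by blast
      then show ?thesis using that False by (simp add: linear_scale[OF lin] field_simps)
    qed (simp add: linear_0[OF lin])
    then have "bounded_linear \<tau>"
      using lin by (intro bounded_linear_intro[where K = "R / \<delta>"]) (auto simp: linear_add linear_scale)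
    then show False using unb by blast
  qed
  \<comment> \<open>A choice \<open>r\<close> pairs a vector with a norming functional of its image.
    The sum outweighs the earlier terms of the series, and the 2 leaves room for the later ones,
    whose total is at most 1.\<close>
  define Q where "Q s n r \<longleftrightarrow> bounded_linear (snd r) \<and> (\<forall>y. \<bar>snd r y\<bar> \<le> norm y)
      \<and> snd r (\<tau> (fst r)) = norm (\<tau> (fst r)) \<and> norm (fst r) \<le> (1/2)^n
      \<and> (\<forall>m<n. \<bar>snd (s m) (\<tau> (fst r))\<bar> \<le> (1/2)^n)
      \<and> real n + 2 + (\<Sum>m<n. norm (\<tau> (fst (s m)))) \<le> norm (\<tau> (fst r))"
    for s :: "nat \<Rightarrow> 'a \<times> ('b \<Rightarrow> real)" and n r
  have "\<exists>s. \<forall>n. Q s n (s n)"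
  proof (rule dependent_wellorder_choice)
    show "Q f x r = Q g x r" if "\<And>y. y < x \<Longrightarrow> f y = g y" for f g x r
      unfolding Q_def using that by (auto intro!: sum.cong)
  next
    fix n s assume IH: "\<And>y. y < n \<Longrightarrow> Q s y (s y)"
    let ?B = "\<lambda>m. onorm (\<lambda>x. snd (s m) (\<tau> x))"
    have bl: "bounded_linear (\<lambda>x. snd (s m) (\<tau> x))" if "m < n" for m
      using IH[OF that] weak unfolding Q_def by blast
    then have B0: "?B m \<ge> 0" if "m < n" for m using that onorm_pos_le by blast
    \<comment> \<open>Small enough to bound by \<open>(1/2)^n\<close> both the norm of the new
      vector and the values of all earlier functionals at its image.\<close>
    define \<delta> where "\<delta> = (1/2)^n / (1 + (\<Sum>m<n. ?B m))"
    have S0: "(\<Sum>m<n. ?B m) \<ge> 0" using B0 by (intro sum_nonneg) auto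
    then have "\<delta> > 0" by (simp add: \<delta>_def add_pos_nonneg)
    then obtain x where x: "norm x \<le> \<delta>" "real n + 2 + (\<Sum>m<n. norm (\<tau> (fst (s m)))) \<le> norm (\<tau> x)"
      using big[of \<delta> "real n + 2 + (\<Sum>m<n. norm (\<tau> (fst (s m))))"]
      by (meson add_nonneg_nonneg add_pos_nonneg norm_ge_zero of_nat_0_le_iff sum_nonneg add_nonneg_pos zero_less_numeral)
    obtain g :: "'b \<Rightarrow> real" where g: "bounded_linear g" "g (\<tau> x) = norm (\<tau> x)" "\<And>y. \<bar>g y\<bar> \<le> norm y"
      using norming_functional by blast
    have \<delta>: "(1 + (\<Sum>m<n. ?B m)) * \<delta> = (1/2)^n" using S0 by (simp add: \<delta>_def)
    have "norm x \<le> (1/2)^n"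
    proof -
      have "1 * \<delta> \<le> (1 + (\<Sum>m<n. ?B m)) * \<delta>" using S0 \<open>\<delta> > 0\<close> by (intro mult_right_mono) auto
      then show ?thesis using x(1) \<delta> by simp
    qed
    moreover have "\<bar>snd (s m) (\<tau> x)\<bar> \<le> (1/2)^n" if "m < n" for m
    proof -
      have "\<bar>snd (s m) (\<tau> x)\<bar> \<le> ?B m * norm x" using onorm[OF bl[OF that], of x] by simp
      also have "\<dots> \<le> (1 + (\<Sum>m<n. ?B m)) * \<delta>"
      proof (rule mult_mono)
        have "?B m \<le> (\<Sum>m<n. ?B m)" using that B0 by (intro member_le_sum) auto
        then show "?B m \<le> 1 + (\<Sum>m<n. ?B m)" by simp
      qed (use x S0 in auto)
      finally show ?thesis using \<delta> by simp
    qed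
    ultimately have "Q s n (x, g)" unfolding Q_def using g x by auto
    then show "\<exists>r. Q s n r" ..
  qed
  then obtain s where s: "\<And>n. Q s n (s n)" by blast
  define x where "x n = fst (s n)" for n
  define g where "g n = snd (s n)" for n
  have g: "bounded_linear (g n)" "\<And>y. \<bar>g n y\<bar> \<le> norm y" "g n (\<tau> (x n)) = norm (\<tau> (x n))"
    and x: "norm (x n) \<le> (1/2)^n" "real n + 2 + (\<Sum>m<n. norm (\<tau> (x m))) \<le> norm (\<tau> (x n))"
    and gx: "\<And>m. m < n \<Longrightarrow> \<bar>g m (\<tau> (x n))\<bar> \<le> (1/2)^n" for n
    using s[of n] by (auto simp: Q_def x_def g_def)
  have sm: "summable x"
    using x(1) by (intro summable_comparison_test'[OF summable_geometric[of "1/2 :: real"]]) auto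
  have "real n \<le> norm (\<tau> (suminf x))" for n
  proof -
    let ?a = "\<lambda>m. g n (\<tau> (x m))"
    have bl: "bounded_linear (\<lambda>x. g n (\<tau> x))" using weak g by blast
    have a: "summable ?a" "g n (\<tau> (suminf x)) = suminf ?a"
      using bounded_linear.suminf[OF bl sm] bounded_linear.summable[OF bl sm] by auto
    have tail: "norm (?a (m + Suc n)) \<le> (1/2)^m * (1/2)" for m
    proof -
      have "norm (?a (m + Suc n)) \<le> (1/2)^(m + Suc n)" using gx[of n "m + Suc n"] by simp
      also have "\<dots> \<le> (1/2)^(Suc m)" by (rule power_decreasing) auto
      finally show ?thesis by simp
    qed
    have geo: "(\<lambda>m. (1/2)^m * (1/2) :: real) sums (2 * (1/2))"
      using geometric_sums[of "1/2::real"] by (intro sums_mult2) simp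
    have "\<bar>\<Sum>m. ?a (m + Suc n)\<bar> \<le> (\<Sum>m. (1/2)^m * (1/2))"
      using norm_suminf_le[OF tail sums_summable[OF geo]] by simp
    then have t1: "\<bar>\<Sum>m. ?a (m + Suc n)\<bar> \<le> 1" using sums_unique[OF geo] by simp
    have "suminf ?a = (\<Sum>m. ?a (m + Suc n)) + (\<Sum>m<Suc n. ?a m)"
      by (rule suminf_split_initial_segment[OF a(1)])
    also have "(\<Sum>m<Suc n. ?a m) = norm (\<tau> (x n)) + (\<Sum>m<n. ?a m)" using g(3) by simp
    finally have eq: "suminf ?a = (\<Sum>m. ?a (m + Suc n)) + norm (\<tau> (x n)) + (\<Sum>m<n. ?a m)" by simp
    have "\<bar>\<Sum>m<n. ?a m\<bar> \<le> (\<Sum>m<n. norm (\<tau> (x m)))"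
      by (rule order_trans[OF sum_abs]) (auto intro!: sum_mono g(2))
    \<comment> \<open>The tail contributes at least -1 and the earlier terms at least minus their
      norms, so the term at index \<open>n\<close> dominates.\<close>
    then have "real n + 1 \<le> suminf ?a" using eq t1 x(2)[of n] by linarith
    also have "\<dots> \<le> norm (\<tau> (suminf x))" using g(2)[of n "\<tau> (suminf x)"] a(2) by linarith
    finally show ?thesis by simp
  qed
  then show False using reals_Archimedean2[of "norm (\<tau> (suminf x))"] not_le by blast
qed

section \<open>Scalars, functionals and rank-one operators\<close>

text \<open>Values are complex in both cases; \<open>range f \<subseteq> F\<close> makes them real
  when \<open>F\<close> is \<open>\<real>\<close>, so that one theory serves both fields.\<close>

definition functionals :: "complex set \<Rightarrow> ('a::real_normed_vector \<Rightarrow> 'a) \<Rightarrow> ('a \<Rightarrow> complex) set" where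
  "functionals F J = {f. bounded_linear f \<and> range f \<subseteq> F \<and> (\<forall>c\<in>F. \<forall>x. f (csmul J c x) = c * f x)}"

definition rank_one :: "('a::real_normed_vector \<Rightarrow> 'a) \<Rightarrow> 'a \<Rightarrow> ('a \<Rightarrow> complex) \<Rightarrow> 'a \<Rightarrow>\<^sub>L 'a" where
  "rank_one J x f = Blinfun (\<lambda>y. csmul J (f y) x)"

lemma csmul_add_left: "csmul J (c + d) x = csmul J c x + csmul J d x"
  and csmul_minus_left: "csmul J (- c) x = - csmul J c x"
  and csmul_diff_left: "csmul J (c - d) x = csmul J c x - csmul J d x"
  and csmul_0_left: "csmul J 0 x = 0"
  and csmul_1_left: "csmul J 1 x = x"
  and csmul_of_real: "csmul J (of_real r) x = r *\<^sub>R x"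
  by (simp_all add: csmul_def algebra_simps)

locale scalar_field =
  fixes F :: "complex set" and J :: "'a::banach \<Rightarrow> 'a"
  assumes field_cases: "F = \<real> \<or> F = UNIV \<and> complex_structure J"
begin

lemma F_closed [simp, intro]:
  shows "0 \<in> F" "1 \<in> F" "complex_of_real r \<in> F"
    and "c \<in> F \<Longrightarrow> d \<in> F \<Longrightarrow> c + d \<in> F"
    and "c \<in> F \<Longrightarrow> d \<in> F \<Longrightarrow> c - d \<in> F"
    and "c \<in> F \<Longrightarrow> d \<in> F \<Longrightarrow> c * d \<in> F"
    and "c \<in> F \<Longrightarrow> d \<in> F \<Longrightarrow> c / d \<in> F"
    and "c \<in> F \<Longrightarrow> - c \<in> F"
    and "c \<in> F \<Longrightarrow> inverse c \<in> F"
  using field_cases by (auto intro: Reals_add Reals_diff Reals_mult Reals_divide Reals_minus Reals_inverse)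

text \<open>Over the reals \<open>J\<close> is arbitrary, but there \<open>Im c = 0\<close> removes
  it from \<open>csmul\<close>; otherwise the axioms of a complex structure are at hand.\<close>

lemma F_cases:
  assumes "c \<in> F"
  obtains "Im c = 0"
  | "F = UNIV" "bounded_linear J" "\<And>x. J (J x) = - x"
    "\<And>x t. norm (cos t *\<^sub>R x + sin t *\<^sub>R J x) = norm x"
  using field_cases assms by (auto simp: complex_structure_def elim!: Reals_cases)

lemma csmul_add_right: "c \<in> F \<Longrightarrow> csmul J c (x + y) = csmul J c x + csmul J c y"
  and csmul_scaleR: "c \<in> F \<Longrightarrow> csmul J c (r *\<^sub>R x) = r *\<^sub>R csmul J c x"
  by (erule F_cases; simp add: csmul_def linear_add linear_scale bounded_linear.linear algebra_simps)+

lemma csmul_csmul: "c \<in> F \<Longrightarrow> csmul J c (csmul J d x) = csmul J (c * d) x"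
proof (erule F_cases)
  assume "bounded_linear J" and J: "\<And>x. J (J x) = - x"
  then have lin: "J (x + y) = J x + J y" "J (r *\<^sub>R x) = r *\<^sub>R J x" for x y r
    by (simp_all add: linear_add linear_scale bounded_linear.linear)
  show ?thesis by (simp add: csmul_def lin J algebra_simps)
qed (simp add: csmul_def algebra_simps)

lemma linear_csmul: "c \<in> F \<Longrightarrow> linear (csmul J c)"
  by (intro linearI csmul_add_right csmul_scaleR)

lemma csmul_diff_right: "c \<in> F \<Longrightarrow> csmul J c (x - y) = csmul J c x - csmul J c y"
  and csmul_minus_right: "c \<in> F \<Longrightarrow> csmul J c (- x) = - csmul J c x"
  and csmul_0_right: "c \<in> F \<Longrightarrow> csmul J c 0 = 0"
  and csmul_sum_right: "c \<in> F \<Longrightarrow> csmul J c (sum g S) = (\<Sum>i\<in>S. csmul J c (g i))"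
  using linear_csmul by (auto simp: linear_diff linear_neg linear_0 linear_sum)

lemmas csmul_simps = csmul_add_left csmul_minus_left csmul_diff_left csmul_0_left csmul_1_left
  csmul_add_right csmul_csmul csmul_diff_right csmul_minus_right csmul_0_right

lemma norm_csmul: "c \<in> F \<Longrightarrow> norm (csmul J c x) = cmod c * norm x"
proof (erule F_cases)
  assume "Im c = 0"
  then have "c = of_real (Re c)" by (simp add: complex_eq_iff)
  then show ?thesis by (metis csmul_of_real norm_of_real norm_scaleR)
next
  assume n: "\<And>x t. norm (cos t *\<^sub>R x + sin t *\<^sub>R J x) = norm x"
  \<comment> \<open>Polar form of \<open>c\<close>: the unimodular factor preserves the
    norm.\<close>
  have "csmul J c x = cmod c *\<^sub>R (cos (Arg c) *\<^sub>R x + sin (Arg c) *\<^sub>R J x)"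
    by (simp add: csmul_def scaleR_add_right)
      (metis rcis_cmod_Arg Re_rcis Im_rcis)
  then show ?thesis using n by simp
qed

lemma csmul_eq_0: "c \<in> F \<Longrightarrow> csmul J c x = 0 \<longleftrightarrow> c = 0 \<or> x = 0"
  by (metis norm_csmul norm_eq_zero mult_eq_0_iff)

lemma csmul_cancel: "c \<in> F \<Longrightarrow> d \<in> F \<Longrightarrow> x \<noteq> 0 \<Longrightarrow> csmul J c x = csmul J d x \<longleftrightarrow> c = d"
  using csmul_eq_0[of "c - d" x] by (auto simp: csmul_diff_left)

lemma csmulL_apply: "c \<in> F \<Longrightarrow> csmulL J c T x = csmul J c (T x)"
  by (erule F_cases)
    (simp_all add: csmulL_def csmul_def blinfun.add_left blinfun.scaleR_left bounded_linear_Blinfun_apply)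

lemma bounded_ops_csmul: "T \<in> bounded_ops F J \<Longrightarrow> c \<in> F \<Longrightarrow> T (csmul J c x) = csmul J c (T x)"
  by (simp add: bounded_ops_def F_linear_def)

section \<open>Bounded functionals over the scalar field\<close>

lemma functionalsD:
  assumes "f \<in> functionals F J"
  shows functional_bounded_linear: "bounded_linear f"
    and functional_in_F [simp]: "f x \<in> F"
    and functional_csmul: "c \<in> F \<Longrightarrow> f (csmul J c x) = c * f x"
  using assms by (auto simp: functionals_def)

lemma functional_add: "f \<in> functionals F J \<Longrightarrow> f (x + y) = f x + f y"
  and functional_diff: "f \<in> functionals F J \<Longrightarrow> f (x - y) = f x - f y"
  and functional_minus: "f \<in> functionals F J \<Longrightarrow> f (- x) = - f x"
  and functional_0: "f \<in> functionals F J \<Longrightarrow> f 0 = 0"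
  using functional_bounded_linear[of f]
  by (simp_all add: linear_add linear_diff linear_neg linear_0 bounded_linear.linear)

lemmas functional_simps = functional_add functional_diff functional_minus functional_0 functional_csmul

lemma functionals_closed:
  shows functionals_diff: "f \<in> functionals F J \<Longrightarrow> g \<in> functionals F J \<Longrightarrow> (\<lambda>x. f x - g x) \<in> functionals F J"
    and functionals_add: "f \<in> functionals F J \<Longrightarrow> g \<in> functionals F J \<Longrightarrow> (\<lambda>x. f x + g x) \<in> functionals F J"
    and functionals_mult: "f \<in> functionals F J \<Longrightarrow> c \<in> F \<Longrightarrow> (\<lambda>x. c * f x) \<in> functionals F J"
    and functionals_compose: "f \<in> functionals F J \<Longrightarrow> T \<in> bounded_ops F J \<Longrightarrow> (\<lambda>x. f (blinfun_apply T x)) \<in> functionals F J"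
    and functionals_zero: "(\<lambda>x. 0) \<in> functionals F J"
  unfolding functionals_def bounded_ops_def F_linear_def
  by (auto intro!: bounded_linear_sub bounded_linear_add bounded_linear_const_mult
      bounded_linear_compose[of f] blinfun.bounded_linear_right bounded_linear_zero simp: algebra_simps image_subset_iff)

lemma functionals_sum:
  "(\<And>i. i \<in> S \<Longrightarrow> c i \<in> F) \<Longrightarrow> (\<And>i. i \<in> S \<Longrightarrow> f i \<in> functionals F J)
    \<Longrightarrow> (\<lambda>x. \<Sum>i\<in>S. c i * f i x) \<in> functionals F J"
  by (induction S rule: infinite_finite_induct)
    (auto intro!: functionals_add functionals_mult functionals_zero)

text \<open>Over the complex numbers \<open>g x - \<i> * g (J x)\<close> is complex-linear with real
  part \<open>g x\<close>; this carries the real Hahn-Banach result over to both fields.\<close>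

lemma functional_extending_real:
  fixes g :: "'a \<Rightarrow> real"
  assumes g: "bounded_linear g"
  obtains f where "f \<in> functionals F J" "\<And>x. Re (f x) = g x"
proof (cases "F = \<real>")
  case True
  have "bounded_linear (\<lambda>x. complex_of_real (g x))"
    using g by (rule bounded_linear_compose[OF bounded_linear_of_real])
  then have "(\<lambda>x. complex_of_real (g x)) \<in> functionals F J"
    using True g by (auto simp: functionals_def csmul_of_real linear_scale bounded_linear.linear elim!: Reals_cases)
  then show ?thesis using that by fastforce
next
  case False
  then have "bounded_linear J" and J: "\<And>x. J (J x) = - x" and F: "F = UNIV"
    using field_cases by (auto simp: complex_structure_def)
  then have lin: "J (x + y) = J x + J y" "J (r *\<^sub>R x) = r *\<^sub>R J x" for x y r
    by (simp_all add: linear_add linear_scale bounded_linear.linear)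
  have ling: "g (x + y) = g x + g y" "g (r *\<^sub>R x) = r * g x" "g (x - y) = g x - g y" for x y r
    using bounded_linear.linear[OF g] by (simp_all add: linear_add linear_scale linear_diff)
  define f where "f x = complex_of_real (g x) - \<i> * of_real (g (J x))" for x
  have "bounded_linear (\<lambda>x. g (J x))"
    using g \<open>bounded_linear J\<close> by (rule bounded_linear_compose)
  with g have "bounded_linear f"
    unfolding f_def
    by (auto intro!: bounded_linear_sub bounded_linear_const_mult intro: bounded_linear_compose[OF bounded_linear_of_real])
  moreover have "f (csmul J c x) = c * f x" for c x
    by (simp add: f_def csmul_def lin ling J complex_eq_iff algebra_simps)
  ultimately have "f \<in> functionals F J" by (simp add: functionals_def F)
  then show ?thesis using that by (simp add: f_def)
qed

text \<open>A norming functional extends to one whose value at \<open>x\<close> has real part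
  \<open>norm x\<close>, hence is nonzero and can be divided out.\<close>

lemma functional_separating:
  assumes "x \<noteq> 0"
  obtains f where "f \<in> functionals F J" "f x = 1"
proof -
  obtain g :: "'a \<Rightarrow> real" where "bounded_linear g" "g x = norm x" using norming_functional by blast
  then obtain f where f: "f \<in> functionals F J" "Re (f x) = norm x"
    using functional_extending_real by metis
  then have "f x \<noteq> 0" using assms by auto
  then have "inverse (f x) * f x = 1" by simp
  then show ?thesis using that functionals_mult[OF f(1), of "inverse (f x)"] f(1) by auto
qed

lemma functional_eqI:
  assumes "\<And>f. f \<in> functionals F J \<Longrightarrow> f x = f y"
  shows "x = y"
proof (rule ccontr)
  assume "x \<noteq> y"
  then obtain f where "f \<in> functionals F J" "f (x - y) = 1" using functional_separating[of "x - y"] by auto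
  then show False using assms[of f] by (simp add: functional_simps)
qed

section \<open>Rank-one operators\<close>

lemma rank_one_apply: "f \<in> functionals F J \<Longrightarrow> rank_one J x f y = csmul J (f y) x"
proof -
  assume f: "f \<in> functionals F J"
  have "bounded_linear (\<lambda>y. csmul J (f y) x)"
  proof (rule bounded_linear_intro)
    show "norm (csmul J (f y) x) \<le> norm y * (onorm f * norm x)" for y
      using onorm[OF functional_bounded_linear[OF f], of y] f
      by (simp add: norm_csmul mult_right_mono mult.assoc[symmetric] mult.commute[of "norm y"])
    show "csmul J (f (r *\<^sub>R y)) x = r *\<^sub>R csmul J (f y) x" for r y
      using functional_csmul[OF f, of "of_real r" y] f
      by (simp add: csmul_of_real csmul_csmul[symmetric])
  qed (simp add: functional_add f csmul_simps)
  then show ?thesis by (simp add: rank_one_def bounded_linear_Blinfun_apply)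
qed

lemma rank_one_bounded_ops: "f \<in> functionals F J \<Longrightarrow> rank_one J x f \<in> bounded_ops F J"
  by (simp add: bounded_ops_def F_linear_def rank_one_apply functional_simps csmul_csmul)

lemma finite_rank_rank_one: "f \<in> functionals F J \<Longrightarrow> finite_rank (rank_one J x f)"
  unfolding finite_rank_def
  \<comment> \<open>\<open>span\<close> is over the reals, so a complex line takes the two vectors
    \<open>x\<close> and \<open>J x\<close>.\<close>
  by (intro exI[of _ "{x, J x}"])
    (auto simp: rank_one_apply csmul_def intro!: span_add span_scale intro: span_base)

end

section \<open>Quadratic two-by-two matrices, entry by entry\<close>

definition quad2 ::
  "complex set \<Rightarrow> ('a::banach \<Rightarrow> 'a) \<Rightarrow> ('a \<Rightarrow>\<^sub>L 'a) \<Rightarrow> ('a \<Rightarrow>\<^sub>L 'a) \<Rightarrow> ('a \<Rightarrow>\<^sub>L 'a) \<Rightarrow> ('a \<Rightarrow>\<^sub>L 'a) \<Rightarrow> bool" where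
  "quad2 F J A B C D \<longleftrightarrow> (\<exists>a\<in>F. \<exists>b\<in>F. \<forall>x.
     A (A x) + B (C x) = csmul J (a + b) (A x) - csmul J (a * b) x \<and>
     A (B x) + B (D x) = csmul J (a + b) (B x) \<and>
     C (A x) + D (C x) = csmul J (a + b) (C x) \<and>
     C (B x) + D (D x) = csmul J (a + b) (D x) - csmul J (a * b) x)"

lemma quad2I:
  fixes A B C D :: "'a::banach \<Rightarrow>\<^sub>L 'a"
  assumes "a \<in> F" "b \<in> F"
    and "\<And>x. A (A x) + B (C x) = csmul J (a + b) (A x) - csmul J (a * b) x"
    and "\<And>x. A (B x) + B (D x) = csmul J (a + b) (B x)"
    and "\<And>x. C (A x) + D (C x) = csmul J (a + b) (C x)"
    and "\<And>x. C (B x) + D (D x) = csmul J (a + b) (D x) - csmul J (a * b) x"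
  shows "quad2 F J A B C D"
  using assms unfolding quad2_def by blast

lemma quad2E:
  fixes A B C D :: "'a::banach \<Rightarrow>\<^sub>L 'a"
  assumes "quad2 F J A B C D"
  obtains a b where "a \<in> F" "b \<in> F"
    and "\<And>x. A (A x) + B (C x) = csmul J (a + b) (A x) - csmul J (a * b) x"
    and "\<And>x. A (B x) + B (D x) = csmul J (a + b) (B x)"
    and "\<And>x. C (A x) + D (C x) = csmul J (a + b) (C x)"
    and "\<And>x. C (B x) + D (D x) = csmul J (a + b) (D x) - csmul J (a * b) x"
  using assms unfolding quad2_def by blast

context scalar_field begin

text \<open>Pulling the scalars out of the entries, as \<open>quad2\<close> does, is legitimate
  because entries in \<open>bounded_ops F J\<close> commute with scalars.\<close>

lemma quadratic_matrix_2:
  assumes "T \<in> matrices_over 2 (bounded_ops F J)"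
  shows "quadratic_matrix F J 2 T \<longleftrightarrow> quad2 F J (T 0 0) (T 0 1) (T 1 0) (T 1 1)"
proof -
  have T: "T i j (csmul J c x) = csmul J c (T i j x)" if "i < 2" "j < 2" "c \<in> F" for i j c x
    using assms that by (auto simp: matrices_over_def bounded_ops_csmul)
  have all2: "(\<forall>i<2. P i) \<longleftrightarrow> P 0 \<and> P 1" for P :: "nat \<Rightarrow> bool"
    by (auto simp: numeral_2_eq_2 less_Suc_eq)
  have sum2: "(\<Sum>k<2. g k) = g 0 + g 1" for g :: "nat \<Rightarrow> 'a \<Rightarrow>\<^sub>L 'a"
    by (simp add: numeral_2_eq_2)
  have eq: "R = S \<longleftrightarrow> (\<forall>x. R x = S x)" for R S :: "'a \<Rightarrow>\<^sub>L 'a" by (auto intro: blinfun_eqI)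
  show ?thesis
    unfolding quadratic_matrix_def quad2_def
    by (intro bex_cong refl, unfold all2 sum2 eq all_conj_distrib[symmetric], intro all_cong1)
      (auto simp: blinfun.add_left blinfun.diff_left blinfun.diff_right blinfun.add_right csmulL_apply T csmul_simps
        algebra_simps simp del: One_nat_def)
qed

end

section \<open>Bijections compatible with the dual pairing\<close>

context scalar_field begin

text \<open>A vector outside the span is corrected by the \<open>x m\<close> until all
  \<open>f m\<close> vanish on it; then a functional with value 1 there is corrected by the
  \<open>f m\<close> until it kills all \<open>x m\<close>.\<close>

lemma biorthogonal_extend:
  fixes n :: nat
  assumes inf: "infinite_dimensional TYPE('a)"
    and f: "\<And>m. m < n \<Longrightarrow> f m \<in> functionals F J"
    and fx: "\<And>m k. m < n \<Longrightarrow> k < n \<Longrightarrow> f m (x k) = (if m = k then 1 else 0)"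
  obtains g y where "g \<in> functionals F J" "g y = 1" "\<forall>m<n. f m y = 0 \<and> g (x m) = 0"
proof -
  let ?S = "x ` {..<n} \<union> (\<lambda>m. J (x m)) ` {..<n}"
  have "finite ?S" by simp
  then have "span ?S \<noteq> UNIV" using inf unfolding infinite_dimensional_def by metis
  then obtain z where z: "z \<notin> span ?S" by blast
  define y where "y = z - (\<Sum>m<n. csmul J (f m z) (x m))"
  have "(\<Sum>m<n. csmul J (f m z) (x m)) \<in> span ?S"
    unfolding csmul_def by (intro span_sum span_add span_scale) (auto intro: span_base)
  then have "y \<noteq> 0" using z by (auto simp: y_def)
  have fy: "f k y = 0" if "k < n" for k
  proof -
    have "f k (\<Sum>m<n. csmul J (f m z) (x m)) = (\<Sum>m<n. f k (csmul J (f m z) (x m)))"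
      using functional_bounded_linear[OF f[OF that]] by (simp add: linear_sum bounded_linear.linear)
    also have "\<dots> = (\<Sum>m<n. if m = k then f k z else 0)"
      using that by (intro sum.cong) (auto simp: functional_csmul f fx)
    finally show ?thesis using that by (simp add: y_def functional_simps f)
  qed
  obtain g0 where g0: "g0 \<in> functionals F J" "g0 y = 1"
    using functional_separating[OF \<open>y \<noteq> 0\<close>] by blast
  define g where "g w = g0 w - (\<Sum>m<n. g0 (x m) * f m w)" for w
  have "g \<in> functionals F J"
    unfolding g_def using g0(1) f by (intro functionals_diff functionals_sum) auto
  moreover have "g y = 1" using fy g0 by (simp add: g_def)
  moreover have "g (x k) = 0" if "k < n" for k
  proof -
    have "(\<Sum>m<n. g0 (x m) * f m (x k)) = (\<Sum>m<n. if m = k then g0 (x k) else 0)"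
      using that by (intro sum.cong) (auto simp: fx)
    then show ?thesis using that by (simp add: g_def)
  qed
  ultimately show ?thesis using that fy by blast
qed

lemma biorthogonal_sequence:
  assumes inf: "infinite_dimensional TYPE('a)"
  obtains f and x :: "nat \<Rightarrow> 'a" where "\<And>n. f n \<in> functionals F J"
    "\<And>m n. f m (x n) = (if m = n then 1 else 0)"
proof -
  define Q where "Q s n r \<longleftrightarrow> snd r \<in> functionals F J \<and> snd r (fst r) = 1
      \<and> (\<forall>m<n. snd (s m) (fst r) = 0) \<and> (\<forall>m<n. snd r (fst (s m)) = 0)"
    for s :: "nat \<Rightarrow> 'a \<times> ('a \<Rightarrow> complex)" and n r
  have "\<exists>s. \<forall>n. Q s n (s n)"
  proof (rule dependent_wellorder_choice)
    show "Q s n r = Q t n r" if "\<And>m. m < n \<Longrightarrow> s m = t m" for s t n r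
      using that by (auto simp: Q_def)
  next
    fix n s assume IH: "\<And>m. m < n \<Longrightarrow> Q s m (s m)"
    have fx: "snd (s m) (fst (s k)) = (if m = k then 1 else 0)" if "m < n" "k < n" for m k
      using IH[OF that(1)] IH[OF that(2)] by (cases m k rule: linorder_cases) (auto simp: Q_def)
    have f: "snd (s m) \<in> functionals F J" if "m < n" for m using IH[OF that] by (simp add: Q_def)
    obtain g y where "g \<in> functionals F J" "g y = 1" "\<forall>m<n. snd (s m) y = 0 \<and> g (fst (s m)) = 0"
      by (rule biorthogonal_extend[OF inf f fx])
    then have "Q s n (y, g)" by (simp add: Q_def)
    then show "\<exists>r. Q s n r" ..
  qed
  then obtain s where s: "\<And>n. Q s n (s n)" by blast
  have "snd (s m) (fst (s n)) = (if m = n then 1 else 0)" for m n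
    using s[of m] s[of n] by (cases m n rule: linorder_cases) (auto simp: Q_def)
  then show ?thesis using that[of "\<lambda>n. snd (s n)" "\<lambda>n. fst (s n)"] s by (simp add: Q_def)
qed

end

text \<open>This is what \<open>\<phi>\<close> induces on rank-one operators: maps of vectors,
  functionals and scalars, with no linearity assumed. As \<open>\<sigma>\<close> is onto, every
  functional on the target has the form \<open>\<sigma> f\<close> and can test identities between
  values of \<open>\<tau>\<close>.\<close>

locale functional_pairing = X: scalar_field F JX + Y: scalar_field F JY
  for F and JX :: "'a::banach \<Rightarrow> 'a" and JY :: "'b::banach \<Rightarrow> 'b" +
  fixes \<tau> :: "'a \<Rightarrow> 'b" and \<sigma> :: "('a \<Rightarrow> complex) \<Rightarrow> 'b \<Rightarrow> complex" and h :: "complex \<Rightarrow> complex"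
  assumes infinite_dim: "infinite_dimensional TYPE('a)"
    and \<sigma>_image: "\<sigma> ` functionals F JX = functionals F JY"
    and h_inj: "inj_on h F" and h_0 [simp]: "h 0 = 0" and h_1 [simp]: "h 1 = 1"
    and pairing: "f \<in> functionals F JX \<Longrightarrow> \<sigma> f (\<tau> x) = h (f x)"
begin

lemma \<sigma>_functional: "f \<in> functionals F JX \<Longrightarrow> \<sigma> f \<in> functionals F JY"
  using \<sigma>_image by blast

lemma \<sigma>_surj:
  assumes "g \<in> functionals F JY"
  obtains f where "f \<in> functionals F JX" "g = \<sigma> f"
  using assms \<sigma>_image by blast

lemma h_eq_0_iff: "c \<in> F \<Longrightarrow> h c = 0 \<longleftrightarrow> c = 0"
  using h_inj X.F_closed(1) by (metis h_0 inj_onD)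

lemma biorthogonal_pair:
  obtains x1 x2 f1 f2 where "f1 \<in> functionals F JX" "f2 \<in> functionals F JX"
    "f1 x1 = 1" "f1 x2 = 0" "f2 x1 = 0" "f2 x2 = 1"
proof -
  obtain x :: "nat \<Rightarrow> 'a" and f where "\<And>n. f n \<in> functionals F JX"
    "\<And>m n. f m (x n) = (if m = n then 1 else 0)"
    by (rule X.biorthogonal_sequence[OF infinite_dim]; rule that; assumption)
  then show ?thesis using that[of "f 0" "f 1" "x 0" "x 1"] by simp
qed

lemma h_in_F: "c \<in> F \<Longrightarrow> h c \<in> F"
proof -
  assume c: "c \<in> F"
  obtain x1 f1 where f: "f1 \<in> functionals F JX" "f1 x1 = 1" using biorthogonal_pair by metis
  then have "\<sigma> f1 (\<tau> (csmul JX c x1)) = h c" using c by (simp add: pairing X.functional_csmul)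
  then show ?thesis using Y.functional_in_F[OF \<sigma>_functional[OF f(1)]] by metis
qed

lemma \<tau>_0: "\<tau> 0 = 0"
  by (rule Y.functional_eqI, erule \<sigma>_surj)
    (simp add: pairing X.functional_0 Y.functional_0[OF \<sigma>_functional])

text \<open>With \<open>f1 x = 1\<close>, subtract from a test functional \<open>g\<close> the
  multiple of \<open>\<sigma> f1\<close> that agrees with it at \<open>\<tau> x\<close>. The
  difference is some \<open>\<sigma> f\<close> with \<open>h (f x) = 0\<close>; so
  \<open>f x = 0\<close>, and \<open>\<sigma> f\<close> vanishes at \<open>\<tau>\<close> of every
  multiple of \<open>x\<close>.\<close>

lemma \<tau>_csmul:
  assumes c: "c \<in> F"
  shows "\<tau> (csmul JX c x) = csmul JY (h c) (\<tau> x)"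
proof (cases "x = 0")
  case True
  then show ?thesis using c by (simp add: X.csmul_0_right Y.csmul_0_right \<tau>_0 h_in_F)
next
  case False
  then obtain f1 where f1: "f1 \<in> functionals F JX" "f1 x = 1" by (rule X.functional_separating)
  show ?thesis
  proof (rule Y.functional_eqI)
    fix g assume g: "g \<in> functionals F JY"
    then have "(\<lambda>y. g y - g (\<tau> x) * \<sigma> f1 y) \<in> functionals F JY"
      by (intro Y.functionals_diff Y.functionals_mult \<sigma>_functional f1) auto
    then obtain f where f: "f \<in> functionals F JX" "\<And>y. g y - g (\<tau> x) * \<sigma> f1 y = \<sigma> f y"
      by (metis \<sigma>_surj)
    have "h (f x) = 0" using f(2)[of "\<tau> x"] f1 f(1) by (simp add: pairing)
    then have "f x = 0" using f(1) by (simp add: h_eq_0_iff)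
    then have "\<sigma> f (\<tau> (csmul JX c x)) = 0" using f(1) c by (simp add: pairing X.functional_csmul)
    then show "g (\<tau> (csmul JX c x)) = g (csmul JY (h c) (\<tau> x))"
      using f(2)[of "\<tau> (csmul JX c x)"] f1 c g
      by (simp add: pairing X.functional_csmul Y.functional_csmul h_in_F)
  qed
qed

lemma h_mult: "c \<in> F \<Longrightarrow> d \<in> F \<Longrightarrow> h (c * d) = h c * h d"
proof -
  assume cd: "c \<in> F" "d \<in> F"
  obtain x1 f1 where f: "f1 \<in> functionals F JX" "f1 x1 = 1" using biorthogonal_pair by metis
  have "\<sigma> f1 (\<tau> (csmul JX c (csmul JX d x1))) = h (c * d)"
    using f cd by (simp add: pairing X.functional_csmul)
  moreover have "\<sigma> f1 (\<tau> (csmul JX c (csmul JX d x1))) = h c * h d"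
    using f cd by (simp add: \<tau>_csmul Y.functional_csmul[OF \<sigma>_functional] h_in_F pairing)
  ultimately show ?thesis by simp
qed

text \<open>The same correction of test functionals gives
  \<open>\<tau> (x1 + x2) = \<tau> x1 + \<tau> x2\<close> for a biorthogonal pair. Evaluating
  \<open>\<sigma>\<close> of \<open>c * f1 + d * f2\<close> there yields both sides of the
  claim.\<close>

lemma h_add: "c \<in> F \<Longrightarrow> d \<in> F \<Longrightarrow> h (c + d) = h c + h d"
proof -
  assume cd: "c \<in> F" "d \<in> F"
  obtain x1 x2 f1 f2 where f12: "f1 \<in> functionals F JX" "f2 \<in> functionals F JX"
    and v: "f1 x1 = 1" "f1 x2 = 0" "f2 x1 = 0" "f2 x2 = 1"
    using biorthogonal_pair .
  have add: "\<tau> (x1 + x2) = \<tau> x1 + \<tau> x2"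
  proof (rule Y.functional_eqI)
    fix g assume g: "g \<in> functionals F JY"
    then have "(\<lambda>y. g y - (g (\<tau> x1) * \<sigma> f1 y + g (\<tau> x2) * \<sigma> f2 y)) \<in> functionals F JY"
      by (intro Y.functionals_diff Y.functionals_add Y.functionals_mult \<sigma>_functional f12) auto
    then obtain f where f: "f \<in> functionals F JX"
        "(\<lambda>y. g y - (g (\<tau> x1) * \<sigma> f1 y + g (\<tau> x2) * \<sigma> f2 y)) = \<sigma> f"
      by (rule \<sigma>_surj)
    note f = f(1) fun_cong[OF f(2)]
    have "h (f x1) = 0" "h (f x2) = 0"
      using f(2)[of "\<tau> x1"] f(2)[of "\<tau> x2"] f12 v f(1) by (simp_all add: pairing)
    then have "f x1 = 0" "f x2 = 0" using f(1) by (simp_all add: h_eq_0_iff)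
    then have "\<sigma> f (\<tau> (x1 + x2)) = 0" using f(1) by (simp add: pairing X.functional_add)
    then show "g (\<tau> (x1 + x2)) = g (\<tau> x1 + \<tau> x2)"
      using f(2)[of "\<tau> (x1 + x2)"] f12 v g by (simp add: pairing X.functional_add Y.functional_add)
  qed
  let ?f = "\<lambda>x. c * f1 x + d * f2 x"
  have f: "?f \<in> functionals F JX" using cd f12 by (intro X.functionals_add X.functionals_mult)
  have "h (c + d) = \<sigma> ?f (\<tau> (x1 + x2))" using v f12 by (simp add: pairing[OF f] X.functional_add)
  also have "\<dots> = h c + h d"
    using v by (simp add: add Y.functional_add[OF \<sigma>_functional[OF f]] pairing[OF f])
  finally show ?thesis .
qed

lemma \<tau>_add: "\<tau> (x + y) = \<tau> x + \<tau> y"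
  by (rule Y.functional_eqI, erule \<sigma>_surj)
    (simp add: pairing X.functional_add Y.functional_add[OF \<sigma>_functional] h_add)

lemma h_of_nat_mult: "c \<in> F \<Longrightarrow> h (of_nat n * c) = of_nat n * h c"
proof (induction n)
  case (Suc n)
  have "of_nat n * c \<in> F" using X.F_closed(3)[of "real n"] Suc.prems by simp
  with Suc show ?case by (simp add: distrib_right h_add)
qed simp

text \<open>If \<open>h\<close> were unbounded near 0, the coefficients \<open>c n\<close> of a convergent series along a biorthogonal
  sequence could be chosen so that \<open>h (c n)\<close> outgrows the norm of the \<open>n\<close>-th coefficient functional on \<open>Y\<close>.\<close>

lemma h_bounded: "\<exists>K. \<forall>c\<in>F. cmod c \<le> 1 \<longrightarrow> cmod (h c) \<le> K"
proof (rule ccontr)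
  assume unb: "\<nexists>K. \<forall>c\<in>F. cmod c \<le> 1 \<longrightarrow> cmod (h c) \<le> K"
  \<comment> \<open>Since \<open>h c = N * h (c / N)\<close>, unboundedness on the unit disc passes
    to every smaller disc.\<close>
  have big: "\<exists>c\<in>F. cmod c \<le> \<delta> \<and> K \<le> cmod (h c)" if "\<delta> > 0" for \<delta> K
  proof -
    obtain N :: nat where N: "1 / \<delta> < real N" using reals_Archimedean2 by blast
    then have N0: "N > 0" using that by (metis gr0I of_nat_0 divide_pos_pos less_asym zero_less_one)
    obtain c where c: "c \<in> F" "cmod c \<le> 1" "real N * K < cmod (h c)"
      using unb not_le by metis
    let ?c = "of_real (1 / real N) * c"
    have "?c \<in> F" using c by blast
    moreover have "cmod ?c \<le> \<delta>"
    proof -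
      have "cmod ?c \<le> 1 / real N" using c(2) N0 by (simp add: norm_mult norm_divide divide_right_mono)
      also have "\<dots> \<le> \<delta>" using N N0 that by (simp add: field_simps)
      finally show ?thesis .
    qed
    moreover have "h c = of_nat N * h ?c"
      using h_of_nat_mult[OF \<open>?c \<in> F\<close>, of N] N0 by simp
    then have "real N * K < real N * cmod (h ?c)" using c(3) by (simp add: norm_mult)
    then have "K \<le> cmod (h ?c)" using N0 by simp
    ultimately show ?thesis by blast
  qed
  obtain x :: "nat \<Rightarrow> 'a" and f where f: "\<And>n. f n \<in> functionals F JX"
    and fx: "\<And>m n. f m (x n) = (if m = n then 1 else 0)"
    by (rule X.biorthogonal_sequence[OF infinite_dim]; rule that; assumption)
  have "\<exists>c\<in>F. cmod c \<le> (1/2)^n / (1 + norm (x n)) \<and> real n * (1 + onorm (\<sigma> (f n))) \<le> cmod (h c)" for n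
    by (rule big) (simp add: add_pos_nonneg)
  then obtain c where c: "\<And>n. c n \<in> F" "\<And>n. cmod (c n) \<le> (1/2)^n / (1 + norm (x n))"
      "\<And>n. real n * (1 + onorm (\<sigma> (f n))) \<le> cmod (h (c n))"
    by metis
  let ?a = "\<lambda>n. csmul JX (c n) (x n)"
  have "norm (?a n) \<le> (1/2)^n" for n
  proof -
    have "norm (?a n) \<le> (1/2)^n / (1 + norm (x n)) * norm (x n)"
      unfolding X.norm_csmul[OF c(1)] using c(2) by (rule mult_right_mono) simp
    also have "\<dots> = (1/2)^n * (norm (x n) / (1 + norm (x n)))" by simp
    also have "\<dots> \<le> (1/2)^n * 1"
      by (intro mult_left_mono) (auto simp: divide_le_eq_1 add_pos_nonneg)
    finally show ?thesis by simp
  qed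
  then have sm: "summable ?a"
    by (intro summable_comparison_test'[OF summable_geometric[of "1/2 :: real"]]) auto
  define u where "u = suminf ?a"
  have fu: "f n u = c n" for n
  proof -
    have "f n u = (\<Sum>m. f n (?a m))"
      unfolding u_def using bounded_linear.suminf[OF X.functional_bounded_linear[OF f] sm] .
    also have "\<dots> = (\<Sum>m. if m = n then c n else 0)"
      by (intro suminf_cong) (simp add: X.functional_csmul f c fx)
    also have "\<dots> = c n" using suminf_finite[of "{n}" "\<lambda>m. if m = n then c n else 0"] by simp
    finally show ?thesis .
  qed
  \<comment> \<open>\<open>h (c n)\<close> is the value of \<open>\<sigma> (f n)\<close> at
    \<open>\<tau> u\<close>, so its modulus is at most
    \<open>onorm (\<sigma> (f n)) * norm (\<tau> u)\<close>; the single vector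
    \<open>\<tau> u\<close> would have infinite norm.\<close>
  have "real n \<le> norm (\<tau> u)" for n
  proof -
    have bl: "bounded_linear (\<sigma> (f n))" using f by (intro Y.functional_bounded_linear \<sigma>_functional)
    have "real n * (1 + onorm (\<sigma> (f n))) \<le> cmod (\<sigma> (f n) (\<tau> u))"
      using c(3) f by (simp add: pairing fu)
    also have "\<dots> \<le> onorm (\<sigma> (f n)) * norm (\<tau> u)" by (rule onorm[OF bl])
    also have "\<dots> \<le> norm (\<tau> u) * (1 + onorm (\<sigma> (f n)))" by (simp add: algebra_simps)
    finally show ?thesis using onorm_pos_le[OF bl] by (simp add: add_pos_nonneg)
  qed
  then show False using reals_Archimedean2[of "norm (\<tau> u)"] not_le by blast
qed

text \<open>Additivity and \<open>h 1 = 1\<close> fix the integers. The error \<open>h r - r\<close>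
  multiplied by \<open>n\<close> equals the error at the fractional part of \<open>n * r\<close>,
  which is bounded independently of \<open>n\<close>; so it is 0.\<close>

lemma h_of_real: "h (of_real r) = of_real r"
proof -
  obtain K where K: "\<And>c. c \<in> F \<Longrightarrow> cmod c \<le> 1 \<Longrightarrow> cmod (h c) \<le> K" using h_bounded by blast
  have h_nat: "h (of_nat k) = of_nat k" for k using h_of_nat_mult[of 1 k] by simp
  have h_neg: "h (- c) = - h c" if "c \<in> F" for c
    using h_add[OF that, of "- c"] that by (simp add: add_eq_0_iff)
  have h_int: "h (of_int k) = of_int k" for k
  proof (cases k rule: int_cases2)
    case (nonpos n)
    have "of_nat n \<in> F" using X.F_closed(3)[of "real n"] by simp
    then show ?thesis using nonpos h_neg h_nat by simp
  qed (simp add: h_nat)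
  have bd: "real n * cmod (h (of_real r) - of_real r) \<le> K + 1" for n
  proof -
    define s where "s = real n * r - of_int \<lfloor>real n * r\<rfloor>"
    have s: "0 \<le> s" "s \<le> 1" unfolding s_def by linarith+
    have "of_int \<lfloor>real n * r\<rfloor> \<in> F" using X.F_closed(3)[of "of_int \<lfloor>real n * r\<rfloor>"] by simp
    then have "h (of_int \<lfloor>real n * r\<rfloor> + of_real s) = of_int \<lfloor>real n * r\<rfloor> + h (of_real s)"
      by (simp add: h_add h_int)
    moreover have "of_int \<lfloor>real n * r\<rfloor> + complex_of_real s = of_nat n * of_real r" by (simp add: s_def)
    ultimately have "of_nat n * h (of_real r) = of_int \<lfloor>real n * r\<rfloor> + h (of_real s)"
      by (simp add: h_of_nat_mult)
    then have "of_nat n * (h (of_real r) - of_real r) = h (of_real s) - of_real s"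
      by (simp add: s_def algebra_simps)
    then have "real n * cmod (h (of_real r) - of_real r) = cmod (h (of_real s) - of_real s)"
      by (metis norm_mult norm_of_nat)
    also have "\<dots> \<le> cmod (h (of_real s)) + cmod (of_real s)" by (rule norm_triangle_ineq4)
    also have "\<dots> \<le> K + 1" using K[of "of_real s"] s by simp
    finally show ?thesis .
  qed
  show ?thesis
  proof (rule ccontr)
    assume "h (of_real r) \<noteq> of_real r"
    then have "cmod (h (of_real r) - of_real r) > 0" by simp
    then obtain n :: nat where "K + 1 < real n * cmod (h (of_real r) - of_real r)"
      using reals_Archimedean3 by blast
    then show False using bd[of n] by simp
  qed
qed

text \<open>The reals are fixed and, in the complex case, \<open>h \<i>\<close> squares to -1; so it
  is \<open>\<i>\<close> or \<open>- \<i>\<close>, which determines \<open>h\<close>.\<close>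

lemma h_id_or_cnj: "(\<forall>c\<in>F. h c = c) \<or> (F = UNIV \<and> (\<forall>c. h c = cnj c))"
proof (cases "F = \<real>")
  case True
  then show ?thesis using h_of_real by (auto elim!: Reals_cases)
next
  case False
  then have F: "F = UNIV" using X.field_cases by blast
  have "h \<i> * h \<i> = -1" using h_mult[of \<i> \<i>] h_of_real[of "-1"] F by simp
  then have "(h \<i> - \<i>) * (h \<i> + \<i>) = 0" by (simp add: algebra_simps)
  then have "h \<i> = \<i> \<or> h \<i> = - \<i>" by (auto simp: add_eq_0_iff2)
  moreover have h: "h c = of_real (Re c) + h \<i> * of_real (Im c)" for c
  proof -
    have "h c = h (of_real (Re c) + \<i> * of_real (Im c))" by (simp flip: complex_eq)
    then show ?thesis using F by (simp only: h_add h_mult h_of_real UNIV_I)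
  qed
  have "h c = c" if "h \<i> = \<i>" for c using h[of c] that by (simp add: complex_eq_iff)
  moreover have "h c = cnj c" if "h \<i> = - \<i>" for c using h[of c] that by (simp add: complex_eq_iff)
  ultimately show ?thesis using F by blast
qed

text \<open>Identity and conjugation preserve real parts, so the linear and the conjugate-linear
  case share one proof of boundedness.\<close>

lemma Re_pairing: "f \<in> functionals F JX \<Longrightarrow> Re (\<sigma> f (\<tau> x)) = Re (f x)"
  using h_id_or_cnj by (auto simp: pairing)

section \<open>Boundedness of \<open>\<tau>\<close> and of its inverse\<close>

lemma linear_\<tau>: "linear \<tau>"
proof (rule linearI[OF \<tau>_add])
  show "\<tau> (r *\<^sub>R x) = r *\<^sub>R \<tau> x" for r x
    using \<tau>_csmul[of "of_real r" x] by (simp add: csmul_of_real h_of_real)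
qed

text \<open>A bounded real functional is the real part of some \<open>\<sigma> f\<close>, and
  composed with \<open>\<tau>\<close> it becomes the real part of \<open>f\<close>.\<close>

lemma bounded_linear_\<tau>: "bounded_linear \<tau>"
proof (rule weakly_bounded_linear_imp_bounded[OF linear_\<tau>])
  fix g :: "'b \<Rightarrow> real" assume "bounded_linear g"
  then obtain g' where g': "g' \<in> functionals F JY" "\<And>y. Re (g' y) = g y"
    using Y.functional_extending_real by blast
  then obtain f where f: "f \<in> functionals F JX" "g' = \<sigma> f" using \<sigma>_surj by blast
  then have "g (\<tau> x) = Re (f x)" for x using g'(2)[of "\<tau> x"] by (simp add: Re_pairing)
  then show "bounded_linear (\<lambda>x. g (\<tau> x))"
    using bounded_linear_compose[OF bounded_linear_Re X.functional_bounded_linear[OF f(1)]] by simp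
qed

lemma bounded_linear_inv_\<tau>:
  assumes "bij \<tau>"
  shows "bounded_linear (inv \<tau>)"
proof (rule weakly_bounded_linear_imp_bounded)
  have s: "\<tau> (inv \<tau> y) = y" for y using assms by (simp add: bij_is_surj surj_f_inv_f)
  show "linear (inv \<tau>)"
    by (intro linearI injD[OF bij_is_inj[OF assms]])
      (simp_all add: s linear_add[OF linear_\<tau>] linear_scale[OF linear_\<tau>])
  fix g :: "'a \<Rightarrow> real" assume "bounded_linear g"
  then obtain f where f: "f \<in> functionals F JX" "\<And>x. Re (f x) = g x"
    using X.functional_extending_real by blast
  have "g (inv \<tau> y) = Re (\<sigma> f y)" for y
    using Re_pairing[OF f(1), of "inv \<tau> y"] f(2) by (simp add: s)
  then show "bounded_linear (\<lambda>y. g (inv \<tau> y))"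
    using bounded_linear_compose[OF bounded_linear_Re Y.functional_bounded_linear[OF \<sigma>_functional[OF f(1)]]]
    by simp
qed

end

section \<open>Quadratic operator matrices over a standard operator algebra\<close>

definition scalar_operator :: "complex set \<Rightarrow> ('a::real_normed_vector \<Rightarrow> 'a) \<Rightarrow> ('a \<Rightarrow>\<^sub>L 'a) \<Rightarrow> bool" where
  "scalar_operator F J T \<longleftrightarrow> (\<exists>c\<in>F. \<forall>x. T x = csmul J c x)"

text \<open>Excluding scalars excludes 0 and the identity, for which the coefficients of the
  quadratic relation are not unique.\<close>

definition proper_idempotent :: "complex set \<Rightarrow> ('a::real_normed_vector \<Rightarrow> 'a) \<Rightarrow> ('a \<Rightarrow>\<^sub>L 'a) \<Rightarrow> bool" where
  "proper_idempotent F J P \<longleftrightarrow> \<not> scalar_operator F J P \<and> (\<forall>x. P (P x) = P x)"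

locale op_algebra = scalar_field F J for F and J :: "'a::banach \<Rightarrow> 'a" +
  fixes \<A> :: "('a \<Rightarrow>\<^sub>L 'a) set"
  assumes standard: "standard_operator_algebra F J \<A>"
    and infinite_dim: "infinite_dimensional TYPE('a)"
begin

lemma bounded_ops: "T \<in> \<A> \<Longrightarrow> T \<in> bounded_ops F J"
  and id_mem [simp]: "id_blinfun \<in> \<A>"
  and csmulL_mem: "c \<in> F \<Longrightarrow> T \<in> \<A> \<Longrightarrow> csmulL J c T \<in> \<A>"
  and rank_one_mem: "f \<in> functionals F J \<Longrightarrow> rank_one J x f \<in> \<A>"
  using standard rank_one_bounded_ops finite_rank_rank_one
  unfolding standard_operator_algebra_def by blast+

lemma csmul_commute: "T \<in> \<A> \<Longrightarrow> c \<in> F \<Longrightarrow> T (csmul J c x) = csmul J c (T x)"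
  using bounded_ops bounded_ops_csmul by blast

lemma zero_mem [simp]: "0 \<in> \<A>"
proof -
  have "csmulL J 0 id_blinfun = (0 :: 'a \<Rightarrow>\<^sub>L 'a)" by (simp add: csmulL_def)
  then show ?thesis using csmulL_mem[of 0 id_blinfun] by simp
qed

lemma ex_outside_line: "\<exists>z. \<forall>c. z \<noteq> csmul J c x"
proof -
  have "span {x, J x} \<noteq> UNIV"
    using infinite_dim unfolding infinite_dimensional_def by (metis finite.emptyI finite.insertI)
  moreover have "csmul J c x \<in> span {x, J x}" for c
    unfolding csmul_def by (intro span_add span_scale) (auto intro: span_base)
  ultimately show ?thesis by (metis UNIV_eq_I)
qed

lemma ex_nonzero: "\<exists>x::'a. x \<noteq> 0"
  using ex_outside_line[of 0] csmul_0_right[OF F_closed(1)] by metis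

lemma ex_kernel:
  assumes f: "f \<in> functionals F J"
  shows "\<exists>z. z \<noteq> 0 \<and> f z = 0"
proof (cases "\<exists>y. f y \<noteq> 0")
  case True
  then obtain y where y: "f y \<noteq> 0" by blast
  obtain w where w: "\<And>c. w \<noteq> csmul J c y" using ex_outside_line by blast
  have "f w / f y \<in> F" using f by auto
  then have "f (w - csmul J (f w / f y) y) = 0" using f y by (simp add: functional_simps)
  moreover have "w - csmul J (f w / f y) y \<noteq> 0" using w by simp
  ultimately show ?thesis by blast
next
  case False
  then show ?thesis using ex_nonzero by blast
qed

lemma scalar_operator_zero: "scalar_operator F J 0"
  unfolding scalar_operator_def by (intro bexI[of _ 0]) (auto simp: csmul_simps)

text \<open>Infinite dimension gives a nonzero kernel vector of \<open>f\<close>, which would force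
  the scalar to be 0.\<close>

lemma rank_one_nonscalar:
  assumes f: "f \<in> functionals F J" and "x \<noteq> 0" "f y \<noteq> 0"
  shows "\<not> scalar_operator F J (rank_one J x f)"
proof
  assume "scalar_operator F J (rank_one J x f)"
  then obtain c where c: "c \<in> F" "\<And>z. csmul J (f z) x = csmul J c z"
    using f by (auto simp: scalar_operator_def rank_one_apply)
  obtain z where "z \<noteq> 0" "f z = 0" using ex_kernel[OF f] by blast
  then have "c = 0" using c(2)[of z] csmul_eq_0[OF c(1), of z] by (simp add: csmul_simps)
  then have "csmul J (f y) x = 0" using c(2)[of y] by (simp add: csmul_simps)
  then show False using assms by (simp add: csmul_eq_0)
qed

text \<open>A nonscalar operator is linearly independent of the identity: if
  \<open>p \<noteq> p'\<close>, the equation could be solved for \<open>T\<close>.\<close>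

lemma nonscalar_coeffs:
  assumes T: "\<not> scalar_operator F J T" and F: "p \<in> F" "q \<in> F" "p' \<in> F" "q' \<in> F"
    and eq: "\<And>x. csmul J p (T x) - csmul J q x = csmul J p' (T x) - csmul J q' x"
  shows "p = p'" "q = q'"
proof -
  show p: "p = p'"
  proof (rule ccontr)
    assume ne: "p \<noteq> p'"
    have "T x = csmul J ((q - q') / (p - p')) x" for x
    proof -
      have "csmul J (p - p') (T x) = csmul J (q - q') x"
        using eq[of x] by (simp add: csmul_diff_left algebra_simps)
      then have "csmul J (inverse (p - p')) (csmul J (p - p') (T x)) = csmul J (inverse (p - p')) (csmul J (q - q') x)"
        by simp
      then show ?thesis using F ne by (simp add: csmul_csmul csmul_1_left divide_inverse mult.commute)
    qed
    then show False using T F unfolding scalar_operator_def by (metis F_closed(5,7))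
  qed
  obtain x :: 'a where "x \<noteq> 0" using ex_nonzero by blast
  then show "q = q'" using eq[of x] p F by (simp add: csmul_cancel)
qed

section \<open>Operator relations read off from quadratic matrices\<close>

lemma proper_idempotent_coeffs:
  assumes P: "proper_idempotent F J P" and F: "a \<in> F" "b \<in> F"
    and eq: "\<And>x. P (P x) = csmul J (a + b) (P x) - csmul J (a * b) x"
  shows "a + b = 1" "a * b = 0"
  using nonscalar_coeffs[of P "a + b" "a * b" 1 0] assms
  by (auto simp: proper_idempotent_def csmul_1_left csmul_0_left)

text \<open>Both matrices are diagonal. The corner 0 forces \<open>a * b = 0\<close>, the corner
  \<open>id_blinfun\<close> forces \<open>a' + b' - a' * b' = 1\<close>, and as \<open>P\<close> is
  nonscalar the two relations have the same coefficients.\<close>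

lemma proper_idempotent_iff_quad2:
  assumes P: "\<not> scalar_operator F J P"
  shows "proper_idempotent F J P \<longleftrightarrow> quad2 F J P 0 0 0 \<and> quad2 F J P 0 0 id_blinfun"
proof
  assume "proper_idempotent F J P"
  then show "quad2 F J P 0 0 0 \<and> quad2 F J P 0 0 id_blinfun"
    by (intro conjI quad2I[of 0 _ 1]) (auto simp: proper_idempotent_def csmul_simps)
next
  obtain x :: 'a where x: "x \<noteq> 0" using ex_nonzero by blast
  assume q: "quad2 F J P 0 0 0 \<and> quad2 F J P 0 0 id_blinfun"
  from conjunct1[OF q] obtain a b where ab: "a \<in> F" "b \<in> F"
    and 1: "\<And>x. P (P x) = csmul J (a + b) (P x) - csmul J (a * b) x" and 2: "csmul J (a * b) x = 0"
    by (rule quad2E) (simp add: csmul_simps)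
  from conjunct2[OF q] obtain a' b' where ab': "a' \<in> F" "b' \<in> F"
    and 3: "\<And>x. P (P x) = csmul J (a' + b') (P x) - csmul J (a' * b') x"
    and 4: "x = csmul J (a' + b') x - csmul J (a' * b') x"
    by (rule quad2E) simp
  have eq: "a + b = a' + b'" "a * b = a' * b'"
    using nonscalar_coeffs[OF P, of "a + b" "a * b" "a' + b'" "a' * b'"] ab ab' 1 3 by auto
  have "a * b = 0" using csmul_eq_0[of "a * b" x] 2 ab x by blast
  have "csmul J 1 x = csmul J (a' + b' - a' * b') x" using 4 by (simp add: csmul_1_left csmul_diff_left)
  then have "1 = a' + b' - a' * b'" using x ab' by (subst (asm) csmul_cancel) auto
  with eq \<open>a * b = 0\<close> have "a + b = 1" by (metis diff_zero)
  then show "proper_idempotent F J P"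
    using 1 P \<open>a * b = 0\<close> by (simp add: proper_idempotent_def csmul_1_left csmul_0_left)
qed

text \<open>The diagonal entry \<open>P\<close> forces \<open>a + b = 1\<close>, and the upper right
  entry becomes \<open>P T = T\<close>. The two lemmas that follow use the same argument, with
  \<open>T P = T\<close> and \<open>T + T P = T\<close>.\<close>

lemma left_fix_iff_quad2:
  assumes P: "proper_idempotent F J P"
  shows "quad2 F J P T 0 0 \<longleftrightarrow> (\<forall>x. P (T x) = T x)"
proof
  assume "quad2 F J P T 0 0"
  then show "\<forall>x. P (T x) = T x"
  proof (rule quad2E)
    fix a b assume "a \<in> F" "b \<in> F" "\<And>x. P (P x) + T (blinfun_apply 0 x) = csmul J (a + b) (P x) - csmul J (a * b) x"
      and *: "\<And>x. P (T x) + T (blinfun_apply 0 x) = csmul J (a + b) (T x)"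
    then have "a + b = 1" using proper_idempotent_coeffs[OF P] by simp
    then show ?thesis using * by (simp add: csmul_1_left)
  qed
qed (use P in \<open>intro quad2I[of 0 _ 1]; simp add: proper_idempotent_def csmul_simps\<close>)

lemma right_fix_iff_quad2:
  assumes P: "proper_idempotent F J P"
  shows "quad2 F J 0 T 0 P \<longleftrightarrow> (\<forall>x. T (P x) = T x)"
proof
  assume "quad2 F J 0 T 0 P"
  then show "\<forall>x. T (P x) = T x"
  proof (rule quad2E)
    fix a b assume "a \<in> F" "b \<in> F" "\<And>x. blinfun_apply 0 (T x) + P (P x) = csmul J (a + b) (P x) - csmul J (a * b) x"
      and *: "\<And>x. blinfun_apply 0 (T x) + T (P x) = csmul J (a + b) (T x)"
    then have "a + b = 1" using proper_idempotent_coeffs[OF P] by simp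
    then show ?thesis using * by (simp add: csmul_1_left)
  qed
qed (use P in \<open>intro quad2I[of 0 _ 1]; simp add: proper_idempotent_def csmul_simps\<close>)

lemma right_annihilate_iff_quad2:
  assumes P: "proper_idempotent F J P"
  shows "quad2 F J id_blinfun T 0 P \<longleftrightarrow> (\<forall>x. T (P x) = 0)"
proof
  assume "quad2 F J id_blinfun T 0 P"
  then show "\<forall>x. T (P x) = 0"
  proof (rule quad2E)
    fix a b assume "a \<in> F" "b \<in> F" "\<And>x. blinfun_apply 0 (T x) + P (P x) = csmul J (a + b) (P x) - csmul J (a * b) x"
      and *: "\<And>x. id_blinfun (T x) + T (P x) = csmul J (a + b) (T x)"
    then have "a + b = 1" using proper_idempotent_coeffs[OF P] by simp
    then show ?thesis using * by (simp add: csmul_1_left)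
  qed
qed (use P in \<open>intro quad2I[of 0 _ 1]; simp add: proper_idempotent_def csmul_simps\<close>)

text \<open>A rank-one \<open>R\<close> satisfies \<open>R^2 = f x * R\<close>, with roots 0 and
  \<open>f x\<close>, and being nonscalar it satisfies no other such relation; the scalar corner
  must be one of these roots.\<close>

lemma rank_one_eigenvalue_iff_quad2:
  assumes f: "f \<in> functionals F J" and x: "x \<noteq> 0" "f y \<noteq> 0" and c: "c \<in> F"
  shows "quad2 F J (rank_one J x f) 0 0 (csmulL J c id_blinfun) \<longleftrightarrow> c = 0 \<or> c = f x"
proof
  assume "quad2 F J (rank_one J x f) 0 0 (csmulL J c id_blinfun)"
  then obtain a b where ab: "a \<in> F" "b \<in> F"
    and 1: "\<And>z. rank_one J x f (rank_one J x f z) = csmul J (a + b) (rank_one J x f z) - csmul J (a * b) z"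
    and 2: "csmul J (c * c) x = csmul J (a + b) (csmul J c x) - csmul J (a * b) x"
    by (rule quad2E) (simp add: csmulL_apply c csmul_csmul)
  have "csmul J (f x) (rank_one J x f z) - csmul J 0 z = csmul J (a + b) (rank_one J x f z) - csmul J (a * b) z" for z
    using 1[of z] f by (simp add: rank_one_apply functional_simps csmul_simps mult.commute)
  then have p: "a + b = f x" "a * b = 0"
    using nonscalar_coeffs[OF rank_one_nonscalar[OF f x], of "f x" 0 "a + b" "a * b"] f ab by auto
  then have "csmul J (c * c) x = csmul J (f x * c) x"
    using 2 f unfolding p by (simp add: csmul_csmul csmul_0_left)
  then have "c * c = f x * c" using c f x by (subst (asm) csmul_cancel) auto
  then show "c = 0 \<or> c = f x" by auto
next
  assume "c = 0 \<or> c = f x"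
  then show "quad2 F J (rank_one J x f) 0 0 (csmulL J c id_blinfun)"
    using f c by (intro quad2I[of 0 _ "f x"])
      (auto simp: rank_one_apply csmulL_apply functional_simps csmul_csmul csmul_0_left csmul_0_right mult.commute)
qed

lemma rank_one_proper_idempotent:
  assumes f: "f \<in> functionals F J" "f x = 1"
  shows "proper_idempotent F J (rank_one J x f)"
proof -
  have "x \<noteq> 0" "f x \<noteq> 0" using f functional_0[OF f(1)] by auto
  then show ?thesis using f rank_one_nonscalar[OF f(1), of x x]
    by (auto simp: proper_idempotent_def rank_one_apply functional_simps)
qed

text \<open>The roots scale along with the matrix. This permits passing to a unital multiple of
  \<open>\<phi>\<close>.\<close>

lemma quad2_scale_imp:
  assumes "A \<in> \<A>" "B \<in> \<A>" "C \<in> \<A>" "D \<in> \<A>" and c: "c \<in> F"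
    and q: "quad2 F J A B C D"
  shows "quad2 F J (csmulL J c A) (csmulL J c B) (csmulL J c C) (csmulL J c D)"
  using q
proof (rule quad2E)
  fix a b assume ab: "a \<in> F" "b \<in> F"
    and eqs: "\<And>x. A (A x) + B (C x) = csmul J (a + b) (A x) - csmul J (a * b) x"
     "\<And>x. A (B x) + B (D x) = csmul J (a + b) (B x)"
     "\<And>x. C (A x) + D (C x) = csmul J (a + b) (C x)"
     "\<And>x. C (B x) + D (D x) = csmul J (a + b) (D x) - csmul J (a * b) x"
  have e: "csmul J (c * c) (A (A x)) + csmul J (c * c) (B (C x))
        = csmul J (c * c * (a + b)) (A x) - csmul J (c * c * (a * b)) x"
     "csmul J (c * c) (A (B x)) + csmul J (c * c) (B (D x)) = csmul J (c * c * (a + b)) (B x)"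
     "csmul J (c * c) (C (A x)) + csmul J (c * c) (D (C x)) = csmul J (c * c * (a + b)) (C x)"
     "csmul J (c * c) (C (B x)) + csmul J (c * c) (D (D x))
        = csmul J (c * c * (a + b)) (D x) - csmul J (c * c * (a * b)) x" for x
    using eqs[THEN arg_cong[of _ _ "csmul J (c * c)"], of x] c ab
    by (simp_all only: csmul_add_right csmul_diff_right csmul_csmul F_closed)
  have r: "c * a * (c * b) = c * c * (a * b)" "(c * a + c * b) * c = c * c * (a + b)"
    by (simp_all add: algebra_simps)
  show ?thesis
    by (rule quad2I[of "c * a" _ "c * b"])
      (use assms(1-4) c ab in \<open>simp_all add: csmulL_apply csmul_commute csmul_csmul e r\<close>)
qed

lemma csmulL_csmulL: "c \<in> F \<Longrightarrow> d \<in> F \<Longrightarrow> csmulL J c (csmulL J d T) = csmulL J (c * d) T"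
  by (rule blinfun_eqI) (simp add: csmulL_apply csmul_csmul)

lemma csmulL_1: "csmulL J 1 T = T"
  by (rule blinfun_eqI) (simp add: csmulL_apply csmul_1_left)

lemma csmulL_id_eq_iff:
  assumes "c \<in> F" "d \<in> F"
  shows "csmulL J c id_blinfun = csmulL J d id_blinfun \<longleftrightarrow> c = d"
proof -
  obtain x :: 'a where "x \<noteq> 0" using ex_nonzero by blast
  then have "csmulL J c id_blinfun x = csmulL J d id_blinfun x \<longleftrightarrow> c = d"
    using assms by (simp add: csmulL_apply csmul_cancel)
  then show ?thesis by auto
qed

lemma quad2_scale_iff:
  assumes "A \<in> \<A>" "B \<in> \<A>" "C \<in> \<A>" "D \<in> \<A>" and c: "c \<in> F" "c \<noteq> 0"
  shows "quad2 F J (csmulL J c A) (csmulL J c B) (csmulL J c C) (csmulL J c D) \<longleftrightarrow> quad2 F J A B C D"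
proof -
  have "csmulL J (inverse c) (csmulL J c T) = T" for T :: "'a \<Rightarrow>\<^sub>L 'a"
    using c by (simp add: csmulL_csmulL csmulL_1)
  then show ?thesis
    using quad2_scale_imp[OF assms(1-5)]
      quad2_scale_imp[of "csmulL J c A" "csmulL J c B" "csmulL J c C" "csmulL J c D" "inverse c"] assms
    by (auto simp: csmulL_mem)
qed

end

section \<open>Maps preserving quadratic operator matrices\<close>

locale quad2_preserver = X: op_algebra F JX \<A> + Y: op_algebra F JY \<B>
  for F and JX :: "'a::banach \<Rightarrow> 'a" and JY :: "'b::banach \<Rightarrow> 'b" and \<A> \<B> +
  fixes \<phi> :: "('a \<Rightarrow>\<^sub>L 'a) \<Rightarrow> ('b \<Rightarrow>\<^sub>L 'b)"
  assumes bij: "bij_betw \<phi> \<A> \<B>"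
    and quad2: "A \<in> \<A> \<Longrightarrow> B \<in> \<A> \<Longrightarrow> C \<in> \<A> \<Longrightarrow> D \<in> \<A> \<Longrightarrow>
      quad2 F JX A B C D \<longleftrightarrow> quad2 F JY (\<phi> A) (\<phi> B) (\<phi> C) (\<phi> D)"
begin

lemma \<phi>_mem [simp]: "T \<in> \<A> \<Longrightarrow> \<phi> T \<in> \<B>"
  using bij bij_betwE by blast

lemma \<phi>_inj: "S \<in> \<A> \<Longrightarrow> T \<in> \<A> \<Longrightarrow> \<phi> S = \<phi> T \<longleftrightarrow> S = T"
  using bij by (auto simp: bij_betw_def inj_on_eq_iff)

lemma \<phi>_surj:
  assumes "S \<in> \<B>"
  obtains T where "T \<in> \<A>" "\<phi> T = S"
  using assms bij by (metis bij_betw_iff_bijections)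

text \<open>Preservation in both directions is symmetric, so one-sided results about
  \<open>\<phi>\<close> can be reversed.\<close>

lemma inverse_preserver: "quad2_preserver F JY JX \<B> \<A> (inv_into \<A> \<phi>)"
proof unfold_locales
  show "bij_betw (inv_into \<A> \<phi>) \<B> \<A>" using bij by (rule bij_betw_inv_into)
  have "inv_into \<A> \<phi> S \<in> \<A>" "\<phi> (inv_into \<A> \<phi> S) = S" if "S \<in> \<B>" for S
    using that bij by (auto simp: bij_betw_def inv_into_into f_inv_into_f)
  then show "quad2 F JY A B C D \<longleftrightarrow>
      quad2 F JX (inv_into \<A> \<phi> A) (inv_into \<A> \<phi> B) (inv_into \<A> \<phi> C) (inv_into \<A> \<phi> D)"
    if "A \<in> \<B>" "B \<in> \<B>" "C \<in> \<B>" "D \<in> \<B>" for A B C D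
    using that quad2 by simp
qed

text \<open>Every strictly upper triangular operator matrix is quadratic.\<close>

lemma \<phi>_0: "\<phi> 0 = 0"
proof -
  let ?Z = "\<phi> 0"
  have "quad2 F JX 0 T 0 0" for T
    by (rule quad2I[of 0 _ 0]) (auto simp: X.csmul_simps)
  then have q: "quad2 F JY ?Z S ?Z ?Z" if "S \<in> \<B>" for S
    using that quad2[of 0 _ 0 0] by (metis \<phi>_surj X.zero_mem)
  obtain y :: 'b where y: "y \<noteq> 0" using Y.ex_nonzero by blast
  \<comment> \<open>With the identity as corner, the upper right entry makes \<open>2 * ?Z\<close> a
    scalar.\<close>
  from q[OF Y.id_mem] obtain a b where "a \<in> F" "b \<in> F"
    "\<And>x. ?Z (id_blinfun x) + id_blinfun (?Z x) = csmul JY (a + b) (id_blinfun x)"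
    by (rule quad2E) blast
  then obtain p where p: "p \<in> F" "\<And>x. ?Z x + ?Z x = csmul JY p x"
    by (metis Y.F_closed(4) id_blinfun.rep_eq)
  define z where "z = p / 2"
  have zF: "z \<in> F" using p(1) Y.F_closed(3)[of 2] Y.F_closed(7)[of p 2] by (simp add: z_def)
  have "csmul JY p x = csmul JY z x + csmul JY z x" for x
    by (simp flip: csmul_add_left add: z_def)
  then have "2 *\<^sub>R ?Z x = 2 *\<^sub>R csmul JY z x" for x using p(2) by (simp add: scaleR_2)
  then have Z: "?Z x = csmul JY z x" for x by simp
  \<comment> \<open>Otherwise the upper left entry could be solved for the corner \<open>?S\<close>
    and would make a nonscalar rank-one operator scalar.\<close>
  have "z = 0"
  proof (rule ccontr)
    assume "z \<noteq> 0"
    obtain f where f: "f \<in> functionals F JY" "f y = 1" using Y.functional_separating[OF y] by blast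
    let ?S = "rank_one JY y f"
    have S: "?S \<in> \<B>" using f Y.rank_one_mem by blast
    from q[OF S] obtain a b where ab: "a \<in> F" "b \<in> F"
      and 1: "\<And>x. ?Z (?Z x) + ?S (?Z x) = csmul JY (a + b) (?Z x) - csmul JY (a * b) x"
      and 2: "\<And>x. ?Z (?Z x) + ?Z (?Z x) = csmul JY (a + b) (?Z x)"
      by (rule quad2E) blast
    have "?S x = csmul JY (((a + b) * z - a * b - z * z) / z) x" for x
    proof -
      have eq: "csmul JY (z * z) x + csmul JY z (?S x) = csmul JY ((a + b) * z) x - csmul JY (a * b) x"
        using 1[of x] zF ab S by (simp add: Z Y.csmul_csmul Y.csmul_commute)
      have "csmul JY z (?S x) = csmul JY ((a + b) * z - a * b - z * z) x"
        unfolding csmul_diff_left eq[symmetric] by simp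
      then have "csmul JY (inverse z) (csmul JY z (?S x)) = csmul JY (inverse z) (csmul JY ((a + b) * z - a * b - z * z) x)"
        by simp
      then show ?thesis using zF \<open>z \<noteq> 0\<close>
        by (simp add: Y.csmul_csmul csmul_1_left divide_inverse mult.commute)
    qed
    moreover have "((a + b) * z - a * b - z * z) / z \<in> F" using ab zF by (intro Y.F_closed)
    ultimately have "scalar_operator F JY ?S" unfolding scalar_operator_def by blast
    moreover have "\<not> scalar_operator F JY ?S" using f y by (intro Y.rank_one_nonscalar[where y = y]) auto
    ultimately show False by blast
  qed
  then show ?thesis by (intro blinfun_eqI) (simp add: Z csmul_0_left)
qed

text \<open>Take \<open>T\<close> with \<open>\<phi> T = id_blinfun\<close>. The upper triangular
  matrix with diagonal \<open>c, c\<close> and corner \<open>T\<close> has the double root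
  \<open>c\<close>; since \<open>\<phi> 0 = 0\<close>, the corner of the image relation reads
  \<open>2 * ?U = (a + b) I\<close>.\<close>

lemma scalar_image:
  assumes c: "c \<in> F"
  obtains d where "d \<in> F" "\<phi> (csmulL JX c id_blinfun) = csmulL JY d id_blinfun"
proof -
  let ?U = "\<phi> (csmulL JX c id_blinfun)"
  obtain T where T: "T \<in> \<A>" "\<phi> T = id_blinfun" using \<phi>_surj[OF Y.id_mem] by blast
  have "quad2 F JX (csmulL JX c id_blinfun) T 0 (csmulL JX c id_blinfun)"
    by (rule quad2I[OF c c]; unfold csmul_add_left;
        use c T in \<open>simp add: X.csmulL_apply X.csmul_csmul X.csmul_commute X.csmul_0_right\<close>)
  then have "quad2 F JY ?U id_blinfun 0 ?U"
    using quad2[of "csmulL JX c id_blinfun" T 0 "csmulL JX c id_blinfun"] T c \<phi>_0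
    by (simp add: X.csmulL_mem)
  then obtain a b where "a \<in> F" "b \<in> F"
    "\<And>x. ?U (id_blinfun x) + id_blinfun (?U x) = csmul JY (a + b) (id_blinfun x)"
    by (rule quad2E) blast
  then obtain p where p: "p \<in> F" "\<And>x. ?U x + ?U x = csmul JY p x"
    by (metis Y.F_closed(4) id_blinfun.rep_eq)
  define d where "d = p / 2"
  have dF: "d \<in> F" using p(1) Y.F_closed(3)[of 2] Y.F_closed(7)[of p 2] by (simp add: d_def)
  have "csmul JY p x = csmul JY d x + csmul JY d x" for x
    by (simp flip: csmul_add_left add: d_def)
  then have "2 *\<^sub>R ?U x = 2 *\<^sub>R csmul JY d x" for x using p(2) by (simp add: scaleR_2)
  then have "?U = csmulL JY d id_blinfun" by (intro blinfun_eqI) (simp add: Y.csmulL_apply dF)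
  then show ?thesis using that dF by blast
qed

lemma scalar_operator_imp: "T \<in> \<A> \<Longrightarrow> scalar_operator F JX T \<Longrightarrow> scalar_operator F JY (\<phi> T)"
proof -
  assume "scalar_operator F JX T"
  then obtain c where c: "c \<in> F" "\<And>x. T x = csmul JX c x" unfolding scalar_operator_def by blast
  then have "T = csmulL JX c id_blinfun" by (intro blinfun_eqI) (simp add: X.csmulL_apply)
  then obtain d where "d \<in> F" "\<phi> T = csmulL JY d id_blinfun" using scalar_image[OF c(1)] by metis
  then show ?thesis unfolding scalar_operator_def by (auto simp: Y.csmulL_apply)
qed

lemma scalar_operator_iff: "T \<in> \<A> \<Longrightarrow> scalar_operator F JY (\<phi> T) \<longleftrightarrow> scalar_operator F JX T"
proof -
  interpret inverse: quad2_preserver F JY JX \<B> \<A> "inv_into \<A> \<phi>" by (rule inverse_preserver)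
  assume "T \<in> \<A>"
  then show ?thesis
    using scalar_operator_imp[of T] inverse.scalar_operator_imp[of "\<phi> T"] bij
    by (auto simp: bij_betw_def)
qed

end

section \<open>Unital preservers: scalars, idempotents and rank-one idempotents\<close>

locale unital_quad2_preserver = quad2_preserver +
  assumes \<phi>_id: "\<phi> id_blinfun = id_blinfun"
begin

text \<open>For \<open>c \<in> F\<close> such a \<open>d\<close> exists by
  \<open>scalar_image\<close> and is unique by \<open>csmulL_id_eq_iff\<close>.\<close>

definition h :: "complex \<Rightarrow> complex" where
  "h c = (SOME d. d \<in> F \<and> \<phi> (csmulL JX c id_blinfun) = csmulL JY d id_blinfun)"

lemma h_in_F: "c \<in> F \<Longrightarrow> h c \<in> F"
  and \<phi>_scalar: "c \<in> F \<Longrightarrow> \<phi> (csmulL JX c id_blinfun) = csmulL JY (h c) id_blinfun"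
  unfolding h_def by (rule someI2_ex; use scalar_image in blast)+

lemma h_inj: "inj_on h F"
  by (rule inj_onI) (metis X.csmulL_id_eq_iff \<phi>_inj \<phi>_scalar X.csmulL_mem X.id_mem)

lemma h_0: "h 0 = 0" and h_1: "h 1 = 1"
proof -
  have "csmulL JX 0 id_blinfun = 0" "csmulL JY 0 id_blinfun = 0" by (simp_all add: csmulL_def)
  then show "h 0 = 0" using \<phi>_scalar[of 0] \<phi>_0 Y.csmulL_id_eq_iff[of "h 0" 0] h_in_F[of 0] by simp
  show "h 1 = 1"
    using \<phi>_scalar[of 1] \<phi>_id Y.csmulL_id_eq_iff[of "h 1" 1] h_in_F[of 1] by (simp add: X.csmulL_1 Y.csmulL_1)
qed

lemma h_surj:
  assumes "d \<in> F"
  obtains c where "c \<in> F" "h c = d"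
proof -
  interpret inverse: quad2_preserver F JY JX \<B> \<A> "inv_into \<A> \<phi>" by (rule inverse_preserver)
  obtain c where c: "c \<in> F" "inv_into \<A> \<phi> (csmulL JY d id_blinfun) = csmulL JX c id_blinfun"
    using inverse.scalar_image[OF assms] by blast
  have "\<phi> (inv_into \<A> \<phi> (csmulL JY d id_blinfun)) = csmulL JY d id_blinfun"
    using bij assms by (intro f_inv_into_f) (auto simp: bij_betw_def Y.csmulL_mem)
  then have "csmulL JY (h c) id_blinfun = csmulL JY d id_blinfun" using c \<phi>_scalar by simp
  then show ?thesis using that c(1) Y.csmulL_id_eq_iff[OF h_in_F[OF c(1)] assms] by blast
qed

lemma proper_idempotent_iff:
  assumes P: "P \<in> \<A>"
  shows "proper_idempotent F JY (\<phi> P) \<longleftrightarrow> proper_idempotent F JX P"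
proof (cases "scalar_operator F JX P")
  case True
  then show ?thesis using P scalar_operator_iff by (simp add: proper_idempotent_def)
next
  case False
  then show ?thesis
    using P scalar_operator_iff quad2[of P 0 0 0] quad2[of P 0 0 id_blinfun] \<phi>_0 \<phi>_id
    by (simp add: X.proper_idempotent_iff_quad2 Y.proper_idempotent_iff_quad2)
qed

context
  fixes P T assumes P: "P \<in> \<A>" "proper_idempotent F JX P" and T: "T \<in> \<A>"
begin

lemma left_fix_iff: "(\<forall>y. \<phi> P (\<phi> T y) = \<phi> T y) \<longleftrightarrow> (\<forall>x. P (T x) = T x)"
  and right_fix_iff: "(\<forall>y. \<phi> T (\<phi> P y) = \<phi> T y) \<longleftrightarrow> (\<forall>x. T (P x) = T x)"
  and right_annihilate_iff: "(\<forall>y. \<phi> T (\<phi> P y) = 0) \<longleftrightarrow> (\<forall>x. T (P x) = 0)"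
  using P T quad2[of P T 0 0] quad2[of 0 T 0 P] quad2[of id_blinfun T 0 P] \<phi>_0 \<phi>_id proper_idempotent_iff
  by (simp_all add: X.left_fix_iff_quad2[symmetric] Y.left_fix_iff_quad2[symmetric]
      X.right_fix_iff_quad2[symmetric] Y.right_fix_iff_quad2[symmetric]
      X.right_annihilate_iff_quad2[symmetric] Y.right_annihilate_iff_quad2[symmetric])

end

text \<open>A rank-one idempotent is minimal among the proper idempotents, and this is what \<open>\<phi>\<close> preserves.\<close>

lemma rank_one_idempotent_image:
  assumes f: "f \<in> functionals F JX" "f x = 1"
  obtains y g where "g \<in> functionals F JY" "g y = 1" "\<phi> (rank_one JX x f) = rank_one JY y g"
proof -
  let ?P = "rank_one JX x f"
  have P: "?P \<in> \<A>" "proper_idempotent F JX ?P"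
    using f X.rank_one_mem X.rank_one_proper_idempotent by auto
  then have P': "\<phi> ?P \<in> \<B>" "proper_idempotent F JY (\<phi> ?P)" using proper_idempotent_iff by auto
  have "\<phi> ?P \<noteq> 0" using P' Y.scalar_operator_zero by (auto simp: proper_idempotent_def)
  then obtain w where "\<phi> ?P w \<noteq> 0" by (metis blinfun_eqI zero_blinfun.rep_eq)
  define y where "y = \<phi> ?P w"
  have y: "y \<noteq> 0" "\<phi> ?P y = y" using \<open>\<phi> ?P w \<noteq> 0\<close> P' by (auto simp: y_def proper_idempotent_def)
  obtain g0 where g0: "g0 \<in> functionals F JY" "g0 y = 1" using Y.functional_separating[OF y(1)] by blast
  \<comment> \<open>Composing with \<open>\<phi> ?P\<close> places the idempotent \<open>?R\<close>
    below \<open>\<phi> ?P\<close>: multiplying by \<open>\<phi> ?P\<close> on the right leaves it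
    unchanged, and on the left too, as \<open>y\<close> is fixed by
    \<open>\<phi> ?P\<close>.\<close>
  define g where "g z = g0 (\<phi> ?P z)" for z
  have g: "g \<in> functionals F JY" "g y = 1"
    unfolding g_def using g0 y P' Y.bounded_ops Y.functionals_compose by auto
  let ?R = "rank_one JY y g"
  have "?R \<in> \<B>" using g Y.rank_one_mem by blast
  then obtain Q where Q: "Q \<in> \<A>" "\<phi> Q = ?R" by (rule \<phi>_surj)
  have iQ: "proper_idempotent F JX Q"
    using Y.rank_one_proper_idempotent[OF g] Q proper_idempotent_iff by metis
  have "\<phi> ?P (?R z) = ?R z" for z
    using g y P' by (simp add: Y.rank_one_apply Y.csmul_commute)
  then have PQ: "?P (Q z) = Q z" for z using left_fix_iff[OF P Q(1)] Q(2) by metis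
  have "?R (\<phi> ?P z) = ?R z" for z
    using g P' by (simp add: Y.rank_one_apply proper_idempotent_def g_def)
  then have QP: "Q (?P z) = Q z" for z using right_fix_iff[OF P Q(1)] Q(2) by metis
  \<comment> \<open>Lying below a rank-one idempotent, \<open>Q\<close> is the multiple
    \<open>k\<close> of it, and a nonzero idempotent has \<open>k = 1\<close>.\<close>
  define k where "k = f (Q x)"
  have kF: "k \<in> F" using f by (simp add: k_def)
  have Qx: "Q x = csmul JX k x" using PQ[of x] f by (simp add: X.rank_one_apply k_def)
  have Qz: "Q z = csmul JX (f z * k) x" for z
    using QP[of z] f Q kF by (simp add: X.rank_one_apply X.csmul_commute Qx X.csmul_csmul)
  have x: "x \<noteq> 0" using f X.functional_0[OF f(1)] by auto
  have "Q (Q x) = Q x" using iQ by (simp add: proper_idempotent_def)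
  then have "csmul JX (k * k) x = csmul JX k x" using Q kF by (simp add: Qx X.csmul_commute X.csmul_csmul)
  then have "k * k = k" using x kF by (subst (asm) X.csmul_cancel) auto
  moreover have "k \<noteq> 0"
  proof
    assume "k = 0"
    then have "Q = 0" by (intro blinfun_eqI) (simp add: Qz csmul_0_left)
    then show False using iQ X.scalar_operator_zero by (simp add: proper_idempotent_def)
  qed
  ultimately have "k = 1" by simp
  then have "Q = ?P" using f by (intro blinfun_eqI) (simp add: Qz X.rank_one_apply)
  then show ?thesis using that g Q by blast
qed

end

text \<open>A fixed rank-one idempotent and its image act as matrix units: columns
  \<open>x \<otimes> f0\<close> will define \<open>\<tau>\<close>, rows
  \<open>x0 \<otimes> f\<close> will define \<open>\<sigma>\<close>.\<close>

locale pointed_quad2_preserver = unital_quad2_preserver +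
  fixes x0 f0 y0 g0
  assumes f0: "f0 \<in> functionals F JX" "f0 x0 = 1"
    and g0: "g0 \<in> functionals F JY" "g0 y0 = 1"
    and \<phi>_base: "\<phi> (rank_one JX x0 f0) = rank_one JY y0 g0"
begin

definition \<tau> :: "'a \<Rightarrow> 'b" where
  "\<tau> x = \<phi> (rank_one JX x f0) y0"

definition \<sigma> :: "('a \<Rightarrow> complex) \<Rightarrow> 'b \<Rightarrow> complex" where
  "\<sigma> f y = g0 (\<phi> (rank_one JX x0 f) y)"

lemma base_mem: "rank_one JX x0 f0 \<in> \<A>" "proper_idempotent F JX (rank_one JX x0 f0)"
  using f0 X.rank_one_mem X.rank_one_proper_idempotent by auto

lemma y0_nonzero: "y0 \<noteq> 0" and x0_nonzero: "x0 \<noteq> 0"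
  using g0 Y.functional_0[OF g0(1)] f0 X.functional_0[OF f0(1)] by auto

text \<open>Columns satisfy \<open>T P = T\<close> for the base idempotent \<open>P\<close>, a
  relation that \<open>\<phi>\<close> preserves and that makes the image a column again; for rows
  the relation is \<open>P T = T\<close>.\<close>

lemma \<phi>_column: "\<phi> (rank_one JX x f0) = rank_one JY (\<tau> x) g0"
proof (rule blinfun_eqI)
  fix z
  let ?T = "rank_one JX x f0"
  have T: "?T \<in> \<A>" using f0 X.rank_one_mem by blast
  have "\<forall>z. ?T (rank_one JX x0 f0 z) = ?T z"
    using f0 by (simp add: X.rank_one_apply X.functional_simps)
  then have "\<phi> ?T (rank_one JY y0 g0 z) = \<phi> ?T z"
    using right_fix_iff[OF base_mem T] by (metis \<phi>_base)
  then show "\<phi> ?T z = rank_one JY (\<tau> x) g0 z"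
    using g0 T by (simp add: Y.rank_one_apply Y.csmul_commute \<tau>_def)
qed

lemma \<sigma>_functional: "f \<in> functionals F JX \<Longrightarrow> \<sigma> f \<in> functionals F JY"
proof -
  assume "f \<in> functionals F JX"
  then have "\<phi> (rank_one JX x0 f) \<in> bounded_ops F JY"
    by (intro Y.bounded_ops \<phi>_mem X.rank_one_mem)
  then show ?thesis using Y.functionals_compose[OF g0(1)] by (simp add: \<sigma>_def[abs_def])
qed

lemma \<phi>_row:
  assumes f: "f \<in> functionals F JX"
  shows "\<phi> (rank_one JX x0 f) = rank_one JY y0 (\<sigma> f)"
proof (rule blinfun_eqI)
  fix z
  let ?T = "rank_one JX x0 f"
  have T: "?T \<in> \<A>" using f X.rank_one_mem by blast
  have "\<forall>z. rank_one JX x0 f0 (?T z) = ?T z"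
    using f0 f by (simp add: X.rank_one_apply X.functional_simps)
  then have "rank_one JY y0 g0 (\<phi> ?T z) = \<phi> ?T z"
    using left_fix_iff[OF base_mem T] by (metis \<phi>_base)
  then show "\<phi> ?T z = rank_one JY y0 (\<sigma> f) z"
    using g0 \<sigma>_functional[OF f] by (simp add: Y.rank_one_apply \<sigma>_def)
qed

lemma rank_one_zero_left: "rank_one JX 0 f0 = 0"
  using f0 by (intro blinfun_eqI) (simp add: X.rank_one_apply X.csmul_0_right)

lemma \<tau>_0: "\<tau> 0 = 0"
  by (simp add: \<tau>_def rank_one_zero_left \<phi>_0)

lemma bij_\<tau>: "bij \<tau>"
proof (rule bijI)
  show "inj \<tau>"
  proof (rule injI)
    fix x x' assume "\<tau> x = \<tau> x'"
    then have "rank_one JX x f0 = rank_one JX x' f0"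
      using \<phi>_column \<phi>_inj f0 X.rank_one_mem by metis
    then have "rank_one JX x f0 x0 = rank_one JX x' f0 x0" by simp
    then show "x = x'" using f0 by (simp add: X.rank_one_apply csmul_1_left)
  qed
  show "surj \<tau>"
  proof (rule surj_def[THEN iffD2, rule_format])
    fix y
    obtain B where B: "B \<in> \<A>" "\<phi> B = rank_one JY y g0"
      using \<phi>_surj[OF Y.rank_one_mem[OF g0(1)]] by blast
    have "\<forall>z. \<phi> B (rank_one JY y0 g0 z) = \<phi> B z"
      using g0 by (simp add: B Y.rank_one_apply Y.functional_simps)
    \<comment> \<open>The preimage satisfies \<open>B P = B\<close> for the base idempotent
      \<open>P\<close>, so it is itself a column.\<close>
    then have *: "B (rank_one JX x0 f0 z) = B z" for z
      using right_fix_iff[OF base_mem B(1)] by (metis \<phi>_base)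
    have "B = rank_one JX (B x0) f0"
    proof (rule blinfun_eqI)
      fix z
      show "B z = rank_one JX (B x0) f0 z"
        using *[of z] f0 B(1) by (simp add: X.rank_one_apply X.csmul_commute)
    qed
    then have "\<tau> (B x0) = \<phi> B y0" by (simp add: \<tau>_def)
    also have "\<dots> = y" using g0 B by (simp add: Y.rank_one_apply csmul_1_left)
    finally show "\<exists>x. y = \<tau> x" by metis
  qed
qed

lemma \<tau>_eq_0_iff: "\<tau> x = 0 \<longleftrightarrow> x = 0"
  using bij_\<tau> \<tau>_0 by (metis bij_is_inj injD)

lemma \<sigma>_image: "\<sigma> ` functionals F JX = functionals F JY"
proof
  show "functionals F JY \<subseteq> \<sigma> ` functionals F JX"
  proof
    fix g assume g: "g \<in> functionals F JY"
    obtain B where B: "B \<in> \<A>" "\<phi> B = rank_one JY y0 g"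
      using \<phi>_surj[OF Y.rank_one_mem[OF g]] by blast
    have "\<forall>z. rank_one JY y0 g0 (\<phi> B z) = \<phi> B z"
      using g0 g by (simp add: B Y.rank_one_apply Y.functional_simps)
    then have *: "rank_one JX x0 f0 (B z) = B z" for z
      using left_fix_iff[OF base_mem B(1)] by (metis \<phi>_base)
    define f where "f z = f0 (B z)" for z
    have f: "f \<in> functionals F JX"
      unfolding f_def using f0 B X.bounded_ops X.functionals_compose by blast
    then have "B = rank_one JX x0 f"
      using * f0 by (intro blinfun_eqI) (simp add: X.rank_one_apply f_def)
    then have "\<sigma> f z = g z" for z
      using B g g0 by (simp add: \<sigma>_def Y.rank_one_apply Y.functional_simps)
    then have "g = \<sigma> f" by auto
    then show "g \<in> \<sigma> ` functionals F JX" using f by blast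
  qed
qed (use \<sigma>_functional in blast)

lemma \<sigma>_zero: "\<sigma> (\<lambda>x. 0) y = 0"
proof -
  have "rank_one JX x0 (\<lambda>x. 0) = 0"
    by (intro blinfun_eqI) (simp add: X.rank_one_apply X.functionals_zero csmul_0_left)
  then show ?thesis using Y.functional_0[OF g0(1)] by (simp add: \<sigma>_def \<phi>_0)
qed

lemma \<sigma>_nonzero:
  assumes f: "f \<in> functionals F JX" "f u \<noteq> 0"
  obtains w where "\<sigma> f w = 1"
proof -
  have "\<exists>v. \<sigma> f v \<noteq> 0"
  proof (rule ccontr)
    assume "\<nexists>v. \<sigma> f v \<noteq> 0"
    then have "\<phi> (rank_one JX x0 f) = \<phi> 0"
      using \<sigma>_functional[OF f(1)]
      by (intro blinfun_eqI) (simp add: \<phi>_row[OF f(1)] Y.rank_one_apply csmul_0_left \<phi>_0)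
    then have "rank_one JX x0 f = 0" using \<phi>_inj X.rank_one_mem[OF f(1)] by simp
    then have "csmul JX (f u) x0 = 0" using X.rank_one_apply[OF f(1), of x0 u] by simp
    then show False using f x0_nonzero by (simp add: X.csmul_eq_0)
  qed
  then obtain v where v: "\<sigma> f v \<noteq> 0" by blast
  have F: "inverse (\<sigma> f v) \<in> F" using \<sigma>_functional[OF f(1)] by auto
  have "\<sigma> f (csmul JY (inverse (\<sigma> f v)) v) = 1"
    using Y.functional_csmul[OF \<sigma>_functional[OF f(1)] F, of v] v by simp
  then show ?thesis using that by blast
qed

text \<open>The rank-one operator on \<open>X \<oplus> X\<close> with entries \<open>x0 \<otimes> f0\<close>, \<open>x0 \<otimes> f\<close>, \<open>x \<otimes> f0\<close>, \<open>x \<otimes> f\<close> is quadratic;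
  the first three images are known, and they determine the fourth one.\<close>

lemma \<phi>_rank_one_aux:
  assumes f: "f \<in> functionals F JX" "f u \<noteq> 0" and x: "x \<noteq> 0"
  shows "\<phi> (rank_one JX x f) = rank_one JY (\<tau> x) (\<sigma> f)"
proof -
  let ?T = "rank_one JX x f"
  let ?W = "\<phi> ?T"
  let ?t = "\<tau> x"
  have T: "?T \<in> \<A>" "rank_one JX x0 f \<in> \<A>" "rank_one JX x f0 \<in> \<A>"
    using f f0 X.rank_one_mem by auto
  have W: "?W \<in> \<B>" using T by simp
  have sf: "\<sigma> f \<in> functionals F JY" using \<sigma>_functional f by blast
  define s where "s = \<sigma> f ?t"
  have sF: "s \<in> F" using sf by (simp add: s_def)
  \<comment> \<open>A rank-one operator \<open>M\<close> satisfies \<open>M^2 = t M\<close> with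
    \<open>t\<close> its trace, here \<open>f0 x0 + f x = 1 + f x\<close>.\<close>
  have "quad2 F JX (rank_one JX x0 f0) (rank_one JX x0 f) (rank_one JX x f0) ?T"
    by (rule quad2I[of 0 _ "1 + f x"])
      (use f f0 in \<open>simp_all add: X.rank_one_apply X.functional_simps X.csmul_csmul csmul_add_left csmul_1_left
        csmul_0_left mult.commute X.csmul_add_right distrib_left\<close>)
  then have "quad2 F JY (rank_one JY y0 g0) (rank_one JY y0 (\<sigma> f)) (rank_one JY ?t g0) ?W"
    using quad2[OF base_mem(1) T(2,3,1)] \<phi>_base \<phi>_row[OF f(1)] \<phi>_column by simp
  then obtain a b where ab: "a \<in> F" "b \<in> F"
    and e1: "\<And>z. csmul JY (g0 z) y0 + csmul JY (g0 z * s) y0 = csmul JY ((a + b) * g0 z) y0 - csmul JY (a * b) z"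
    and e2: "\<And>z. csmul JY (\<sigma> f z) y0 + csmul JY (\<sigma> f (?W z)) y0 = csmul JY ((a + b) * \<sigma> f z) y0"
    and e3: "\<And>z. csmul JY (g0 z) ?t + ?W (csmul JY (g0 z) ?t) = csmul JY ((a + b) * g0 z) ?t"
    and e4: "\<And>z. csmul JY (\<sigma> f z * g0 y0) ?t + ?W (?W z) = csmul JY (a + b) (?W z) - csmul JY (a * b) z"
    using g0 sf by (elim quad2E) (simp add: Y.rank_one_apply Y.functional_simps Y.csmul_csmul s_def)
  \<comment> \<open>A kernel vector of \<open>g0\<close> isolates \<open>a * b\<close> in the upper
    left entry.\<close>
  have q: "a * b = 0"
  proof -
    obtain z where "z \<noteq> 0" "g0 z = 0" using Y.ex_kernel[OF g0(1)] by blast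
    then show ?thesis using e1[of z] Y.csmul_eq_0[of "a * b" z] ab by (simp add: csmul_0_left)
  qed
  have "csmul JY (1 + s) y0 = csmul JY (a + b) y0"
    using e1[of y0] g0 q by (simp add: csmul_add_left csmul_0_left)
  then have p: "a + b = 1 + s" using y0_nonzero ab sF by (subst (asm) Y.csmul_cancel) auto
  have Wt: "?W ?t = csmul JY s ?t"
    using e3[of y0] g0 p by (simp add: csmul_add_left csmul_1_left)
  have WW: "csmul JY (\<sigma> f z) ?t + ?W (?W z) = csmul JY (1 + s) (?W z)" for z
    using e4[of z] g0 p q by (simp add: csmul_0_left)
  \<comment> \<open>The idempotent \<open>x \<otimes> k\<close> fixes \<open>?T\<close> from the
    left, so its image confines the range of \<open>?W\<close> to the line of
    \<open>y\<close>.\<close>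
  obtain k where k: "k \<in> functionals F JX" "k x = 1" using X.functional_separating[OF x] by blast
  obtain y g where g: "g \<in> functionals F JY" "g y = 1" and Pk: "\<phi> (rank_one JX x k) = rank_one JY y g"
    by (rule rank_one_idempotent_image[OF k])
  have "\<forall>z. rank_one JX x k (?T z) = ?T z"
    using f k by (simp add: X.rank_one_apply X.functional_simps)
  then have "\<forall>z. \<phi> (rank_one JX x k) (?W z) = ?W z"
    using left_fix_iff[OF X.rank_one_mem[OF k(1)] X.rank_one_proper_idempotent[OF k] T(1)] by blast
  then have Wy: "?W z = csmul JY (g (?W z)) y" for z
    using g by (simp add: Pk Y.rank_one_apply)
  have t0: "?t \<noteq> 0" using x \<tau>_eq_0_iff by simp
  obtain w where w: "\<sigma> f w = 1" using \<sigma>_nonzero[OF f] by blast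
  \<comment> \<open>Evaluating \<open>WW\<close> at \<open>w\<close>, where
    \<open>\<sigma> f w = 1\<close>, writes \<open>?t\<close> as the multiple \<open>c\<close> of
    \<open>y\<close>; so the range of \<open>?W\<close> lies on the line of
    \<open>?t\<close>.\<close>
  define c where "c = (1 + s) * g (?W w) - g (?W w) * g (?W y)"
  have cF: "c \<in> F" using g sF unfolding c_def by (intro Y.F_closed) auto
  have "?W (?W w) = csmul JY (g (?W w)) (?W y)"
    by (subst Wy) (use g W in \<open>simp add: Y.csmul_commute\<close>)
  also have "\<dots> = csmul JY (g (?W w) * g (?W y)) y"
    using Wy[of y] g by (metis Y.csmul_csmul Y.functional_in_F)
  finally have "?W (?W w) = csmul JY (g (?W w) * g (?W y)) y" .
  moreover have "csmul JY (1 + s) (?W w) = csmul JY ((1 + s) * g (?W w)) y"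
    using Wy[of w] sF by (metis Y.csmul_csmul Y.F_closed(2,4))
  ultimately have tc: "?t = csmul JY c y"
    using WW[of w] w by (simp add: csmul_1_left c_def csmul_diff_left eq_diff_eq)
  then have c0: "c \<noteq> 0" using t0 by (auto simp: csmul_0_left)
  define v where "v z = g (?W z) / c" for z
  have vF: "v z \<in> F" for z using g cF by (auto simp: v_def)
  have Wv: "?W z = csmul JY (v z) ?t" for z
  proof -
    have "csmul JY (v z) ?t = csmul JY (g (?W z)) y"
      unfolding tc Y.csmul_csmul[OF vF] using c0 by (simp add: v_def)
    then show ?thesis using Wy[of z] by simp
  qed
  \<comment> \<open>Inserting \<open>Wv\<close> and \<open>Wt\<close> into \<open>WW\<close> leaves
    \<open>\<sigma> f z = (1 + s) * v z - v z * s\<close>.\<close>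
  have "v z = \<sigma> f z" for z
  proof -
    have "?W (?W z) = csmul JY (v z * s) ?t"
      using Wv[of z] W vF by (simp add: Y.csmul_commute Wt Y.csmul_csmul)
    moreover have "csmul JY (1 + s) (?W z) = csmul JY ((1 + s) * v z) ?t"
      using Wv[of z] sF by (simp add: Y.csmul_csmul)
    ultimately have "csmul JY (\<sigma> f z) ?t = csmul JY ((1 + s) * v z - v z * s) ?t"
      using WW[of z] by (simp add: csmul_diff_left eq_diff_eq)
    then have "\<sigma> f z = (1 + s) * v z - v z * s"
      using t0 sf vF sF by (subst (asm) Y.csmul_cancel) auto
    then show ?thesis by (simp add: algebra_simps)
  qed
  then show ?thesis using Wv sf by (intro blinfun_eqI) (simp add: Y.rank_one_apply)
qed

lemma \<phi>_rank_one:
  assumes f: "f \<in> functionals F JX"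
  shows "\<phi> (rank_one JX x f) = rank_one JY (\<tau> x) (\<sigma> f)"
proof (cases "x = 0 \<or> (\<forall>u. f u = 0)")
  case True
  then have "rank_one JX x f = 0"
    using f by (intro blinfun_eqI) (auto simp: X.rank_one_apply X.csmul_0_right csmul_0_left)
  moreover have "rank_one JY (\<tau> x) (\<sigma> f) = 0"
  proof (cases "x = 0")
    case True
    then show ?thesis using \<sigma>_functional[OF f]
      by (intro blinfun_eqI) (simp add: Y.rank_one_apply \<tau>_0 Y.csmul_0_right)
  next
    case False
    then have "f = (\<lambda>x. 0)" using True by auto
    then show ?thesis using \<sigma>_functional[OF f]
      by (intro blinfun_eqI) (simp add: Y.rank_one_apply \<sigma>_zero csmul_0_left)
  qed
  ultimately show ?thesis by (simp add: \<phi>_0)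
qed (use \<phi>_rank_one_aux[OF f] in blast)

text \<open>For nonzero \<open>x\<close> and \<open>f\<close> the eigenvalue test matches
  \<open>{0, f x}\<close> with \<open>{0, \<sigma> f (\<tau> x)}\<close> under the bijection
  \<open>h\<close>, which fixes 0.\<close>

lemma \<sigma>_\<tau>:
  assumes f: "f \<in> functionals F JX"
  shows "\<sigma> f (\<tau> x) = h (f x)"
proof (cases "x = 0 \<or> (\<forall>u. f u = 0)")
  case True
  show ?thesis
  proof (cases "x = 0")
    case True
    then show ?thesis using f \<sigma>_functional[OF f]
      by (simp add: \<tau>_0 X.functional_0 Y.functional_0 h_0)
  next
    case False
    then have "f = (\<lambda>x. 0)" using True by auto
    then show ?thesis by (simp add: \<sigma>_zero h_0)
  qed
next
  case False
  then obtain u where x: "x \<noteq> 0" and u: "f u \<noteq> 0" by blast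
  let ?s = "\<sigma> f (\<tau> x)"
  obtain w where w: "\<sigma> f w = 1" using \<sigma>_nonzero[OF f u] by blast
  have *: "h c = 0 \<or> h c = ?s \<longleftrightarrow> c = 0 \<or> c = f x" if c: "c \<in> F" for c
    using X.rank_one_eigenvalue_iff_quad2[OF f x u c]
      Y.rank_one_eigenvalue_iff_quad2[OF \<sigma>_functional[OF f], of "\<tau> x" w "h c"]
      quad2[of "rank_one JX x f" 0 0 "csmulL JX c id_blinfun"] f c x w
    by (simp add: X.rank_one_mem X.csmulL_mem \<phi>_0 \<phi>_scalar \<phi>_rank_one \<tau>_eq_0_iff h_in_F)
  have inj: "h c = h d \<longleftrightarrow> c = d" if "c \<in> F" "d \<in> F" for c d
    using h_inj that by (auto dest: inj_onD)
  show ?thesis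
  proof (cases "f x = 0")
    case True
    obtain c where c: "c \<in> F" "h c = ?s"
      using h_surj[OF Y.functional_in_F[OF \<sigma>_functional[OF f]]] by blast
    then have "c = 0" using *[of c] True by auto
    then show ?thesis using c True by simp
  next
    case False
    then have "h (f x) \<noteq> 0" using inj[of "f x" 0] f h_0 by simp
    then show ?thesis using *[of "f x"] f by auto
  qed
qed

sublocale pair: functional_pairing F JX JY \<tau> \<sigma> h
  using X.infinite_dim \<sigma>_image h_inj h_0 h_1 \<sigma>_\<tau> by unfold_locales

text \<open>For \<open>f (T x) = 1\<close> the matrix with rows \<open>- x \<otimes> f T\<close>, \<open>- x \<otimes> f\<close> and \<open>T\<close>, \<open>T x \<otimes> f\<close> has square 0.\<close>

lemma intertwining:
  assumes T: "T \<in> \<A>"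
  shows "\<phi> T (\<tau> x) = \<tau> (T x)"
proof (cases "T x = 0")
  case True
  show ?thesis
  proof (cases "x = 0")
    case True
    then show ?thesis using T by (simp add: \<tau>_0)
  next
    case False
    then obtain f where f: "f \<in> functionals F JX" "f x = 1" by (rule X.functional_separating)
    \<comment> \<open>As \<open>T\<close> kills the range of the idempotent
      \<open>x \<otimes> f\<close>, \<open>\<phi> T\<close> kills the range of its image, which
      contains \<open>\<tau> x\<close>.\<close>
    have "\<forall>z. T (rank_one JX x f z) = 0"
      using f True T by (simp add: X.rank_one_apply X.csmul_commute X.csmul_0_right)
    then have "\<phi> T (\<phi> (rank_one JX x f) (\<tau> x)) = 0"
      using right_annihilate_iff[OF X.rank_one_mem[OF f(1)] X.rank_one_proper_idempotent[OF f] T] by blast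
    moreover have "\<phi> (rank_one JX x f) (\<tau> x) = \<tau> x"
      using f \<sigma>_functional[OF f(1)] by (simp add: \<phi>_rank_one Y.rank_one_apply \<sigma>_\<tau> h_1 csmul_1_left)
    ultimately show ?thesis using True by (simp add: \<tau>_0)
  qed
next
  case False
  then obtain f where f: "f \<in> functionals F JX" "f (T x) = 1" by (rule X.functional_separating)
  define k where "k z = f (T z)" for z
  have k: "k \<in> functionals F JX" "k x = 1"
    unfolding k_def using X.functionals_compose[OF f(1) X.bounded_ops[OF T]] f by auto
  let ?t = "\<tau> x" and ?u = "\<tau> (T x)"
  let ?A = "rank_one JX (- x) k" and ?B = "rank_one JX (- x) f" and ?D = "rank_one JX (T x) f"
  have "quad2 F JX ?A ?B T ?D"
    by (rule quad2I[of 0 _ 0])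
      (use f k T in \<open>simp_all add: X.rank_one_apply X.functional_simps X.csmul_minus_right X.csmul_csmul
        X.csmul_commute blinfun.minus_right k_def[symmetric] csmul_0_left csmul_1_left csmul_minus_left\<close>)
  then have q: "quad2 F JY (\<phi> ?A) (\<phi> ?B) (\<phi> T) (\<phi> ?D)"
    using quad2[of ?A ?B T ?D] f k T by (simp add: X.rank_one_mem)
  have neg: "\<tau> (- x) = - ?t" using linear_neg[OF pair.linear_\<tau>] .
  have A: "\<phi> ?A z = - csmul JY (\<sigma> k z) ?t" and B: "\<phi> ?B z = - csmul JY (\<sigma> f z) ?t"
    and D: "\<phi> ?D z = csmul JY (\<sigma> f z) ?u" for z
    using f k \<sigma>_functional
    by (simp_all add: \<phi>_rank_one Y.rank_one_apply neg Y.csmul_minus_right)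
  have sk: "\<sigma> k ?t = 1" and sf: "\<sigma> f ?u = 1" using f k by (simp_all add: \<sigma>_\<tau> h_1)
  have \<sigma>: "\<sigma> k \<in> functionals F JY" "\<sigma> f \<in> functionals F JY" using f k \<sigma>_functional by auto
  have "x \<noteq> 0" using False by auto
  then have t0: "?t \<noteq> 0" by (simp add: \<tau>_eq_0_iff)
  obtain a b where ab: "a \<in> F" "b \<in> F"
    and e1: "\<And>z. \<phi> ?A (\<phi> ?A z) + \<phi> ?B (\<phi> T z) = csmul JY (a + b) (\<phi> ?A z) - csmul JY (a * b) z"
    and e2: "\<And>z. \<phi> ?A (\<phi> ?B z) + \<phi> ?B (\<phi> ?D z) = csmul JY (a + b) (\<phi> ?B z)"
    and e3: "\<And>z. \<phi> T (\<phi> ?A z) + \<phi> ?D (\<phi> T z) = csmul JY (a + b) (\<phi> T z)"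
    using q by (rule quad2E) blast
  \<comment> \<open>At \<open>?u\<close> the left side of the upper right entry is
    \<open>?t - ?t\<close>.\<close>
  have p: "a + b = 0"
  proof -
    have "csmul JY (a + b) ?t = 0"
      using e2[of ?u] ab sf sk \<sigma>
      by (simp add: A B D Y.functional_simps csmul_1_left csmul_minus_left Y.csmul_minus_right)
    then show ?thesis using Y.csmul_eq_0[of "a + b" ?t] ab t0 by blast
  qed
  \<comment> \<open>Otherwise a nonzero kernel vector of \<open>\<sigma> k\<close> would, by the
    upper left entry, be a multiple of \<open>?t\<close>, where \<open>\<sigma> k\<close> is
    1.\<close>
  have q: "a * b = 0"
  proof (rule ccontr)
    assume ne: "a * b \<noteq> 0"
    obtain z where z: "z \<noteq> 0" "\<sigma> k z = 0" using Y.ex_kernel[OF \<sigma>(1)] by blast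
    let ?r = "\<sigma> f (\<phi> T z)"
    have r: "csmul JY ?r ?t = csmul JY (a * b) z"
      using e1[of z] p z \<sigma> by (simp add: A B csmul_0_left Y.functional_0)
    then have "\<sigma> k (csmul JY ?r ?t) = \<sigma> k (csmul JY (a * b) z)" by simp
    then have "?r = 0" using \<sigma> ab sk z by (simp add: Y.functional_csmul)
    then have "csmul JY (a * b) z = 0" using r by (simp add: csmul_0_left)
    then show False using Y.csmul_eq_0[of "a * b" z] ab ne z by blast
  qed
  \<comment> \<open>The upper left entry at \<open>?t\<close> now gives \<open>?r = 1\<close>, and
    the lower left entry at \<open>?t\<close> reads \<open>- \<phi> T ?t + ?u = 0\<close>.\<close>
  let ?r = "\<sigma> f (\<phi> T ?t)"
  have "csmul JY ?r ?t = csmul JY 1 ?t"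
    using e1[of ?t] p q sk \<sigma>
    by (simp add: A B csmul_0_left csmul_1_left Y.functional_simps csmul_minus_left)
  then have r: "?r = 1" using \<sigma> t0 by (subst (asm) Y.csmul_cancel) auto
  show ?thesis
    using e3[of ?t] p sk r by (simp add: A D csmul_0_left csmul_1_left blinfun.minus_right)
qed

end

theorem (in unital_quad2_preserver) unital_spatial:
  "\<exists>A :: 'a \<Rightarrow>\<^sub>L 'b. \<exists>B :: 'b \<Rightarrow>\<^sub>L 'a. B o\<^sub>L A = id_blinfun \<and> A o\<^sub>L B = id_blinfun \<and>
     (F_linear F JX JY A \<or> F = UNIV \<and> F_conj_linear F JX JY A) \<and>
     (\<forall>T\<in>\<A>. \<phi> T = A o\<^sub>L T o\<^sub>L B)"
proof -
  obtain x0 :: 'a where "x0 \<noteq> 0" using X.ex_nonzero by blast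
  then obtain f0 where f0: "f0 \<in> functionals F JX" "f0 x0 = 1" by (rule X.functional_separating)
  obtain y0 g0 where "g0 \<in> functionals F JY" "g0 y0 = 1" "\<phi> (rank_one JX x0 f0) = rank_one JY y0 g0"
    by (rule rank_one_idempotent_image[OF f0])
  then interpret pointed_quad2_preserver F JX JY \<A> \<B> \<phi> x0 f0 y0 g0
    using f0 by unfold_locales
  have A: "blinfun_apply (Blinfun \<tau>) = \<tau>"
    using pair.bounded_linear_\<tau> by (rule bounded_linear_Blinfun_apply)
  have B: "blinfun_apply (Blinfun (inv \<tau>)) = inv \<tau>"
    using pair.bounded_linear_inv_\<tau>[OF bij_\<tau>] by (rule bounded_linear_Blinfun_apply)
  have inv: "inv \<tau> (\<tau> x) = x" "\<tau> (inv \<tau> y) = y" for x y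
    using bij_\<tau> by (simp_all add: bij_is_inj bij_is_surj surj_f_inv_f)
  have "F_linear F JX JY \<tau> \<or> F = UNIV \<and> F_conj_linear F JX JY \<tau>"
    using pair.h_id_or_cnj by (auto simp: F_linear_def F_conj_linear_def pair.\<tau>_csmul)
  then show ?thesis
    using intertwining inv
    by (intro exI[of _ "Blinfun \<tau>"] exI[of _ "Blinfun (inv \<tau>)"] conjI ballI blinfun_eqI)
      (simp_all add: A B, metis)
qed

section \<open>The equivalence\<close>

text \<open>Scalars go to scalars, so the identity goes to a multiple \<open>u\<close> of the
  identity, with \<open>u \<noteq> 0\<close> by injectivity. Dividing by \<open>u\<close> gives a
  unital preserver, and \<open>u\<close> returns as the scalar factor.\<close>

theorem (in quad2_preserver) spatial:
  "\<exists>A :: 'a \<Rightarrow>\<^sub>L 'b. \<exists>B :: 'b \<Rightarrow>\<^sub>L 'a. \<exists>c\<in>F. B o\<^sub>L A = id_blinfun \<and> A o\<^sub>L B = id_blinfun \<and>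
     (F_linear F JX JY A \<or> F = UNIV \<and> F_conj_linear F JX JY A) \<and>
     (\<forall>T\<in>\<A>. \<phi> T = csmulL JY c (A o\<^sub>L T o\<^sub>L B))"
proof -
  obtain u where u: "u \<in> F" "\<phi> id_blinfun = csmulL JY u id_blinfun"
    using scalar_image[of 1] by (metis X.F_closed(2) X.csmulL_1)
  have "u \<noteq> 0"
  proof
    assume "u = 0"
    then have "\<phi> id_blinfun = \<phi> 0" using u \<phi>_0 by (simp add: csmulL_def)
    then have "id_blinfun = (0 :: 'a \<Rightarrow>\<^sub>L 'a)" by (simp add: \<phi>_inj)
    then have "x = 0" for x :: 'a by (metis id_blinfun.rep_eq zero_blinfun.rep_eq)
    then show False using X.ex_nonzero by blast
  qed
  define \<psi> where "\<psi> T = csmulL JY (inverse u) (\<phi> T)" for T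
  have v: "inverse u \<in> F" "inverse u \<noteq> 0" using u \<open>u \<noteq> 0\<close> by auto
  have \<phi>: "\<phi> T = csmulL JY u (\<psi> T)" for T
    using u v \<open>u \<noteq> 0\<close> by (simp add: \<psi>_def Y.csmulL_csmulL Y.csmulL_1)
  interpret unital: unital_quad2_preserver F JX JY \<A> \<B> \<psi>
  proof unfold_locales
    have "bij_betw (csmulL JY (inverse u)) \<B> \<B>"
      by (rule bij_betw_byWitness[where f' = "csmulL JY u"])
        (use u v \<open>u \<noteq> 0\<close> in \<open>auto simp: Y.csmulL_csmulL Y.csmulL_1 Y.csmulL_mem\<close>)
    then show "bij_betw \<psi> \<A> \<B>"
      using bij_betw_trans[OF bij] by (simp add: \<psi>_def[abs_def] comp_def)
    show "quad2 F JX A B C D \<longleftrightarrow> quad2 F JY (\<psi> A) (\<psi> B) (\<psi> C) (\<psi> D)"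
      if "A \<in> \<A>" "B \<in> \<A>" "C \<in> \<A>" "D \<in> \<A>" for A B C D
      using that v quad2 by (simp add: \<psi>_def Y.quad2_scale_iff)
    show "\<psi> id_blinfun = id_blinfun"
      using u v \<open>u \<noteq> 0\<close> by (simp add: \<psi>_def Y.csmulL_csmulL Y.csmulL_1)
  qed
  show ?thesis using unital.unital_spatial u(1) \<phi> by metis
qed

section \<open>Similarity and quadratic matrices of every size\<close>

lemma (in scalar_field) quadratic_matrix_iff:
  "quadratic_matrix F J n T \<longleftrightarrow> (\<exists>a\<in>F. \<exists>b\<in>F. \<forall>i<n. \<forall>j<n. \<forall>x.
     (\<Sum>k<n. (T i k - (if i = k then csmulL J a id_blinfun else 0))
        ((T k j - (if k = j then csmulL J b id_blinfun else 0)) x)) = 0)"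
proof -
  have eq: "R = 0 \<longleftrightarrow> (\<forall>x. R x = 0)" for R :: "'a \<Rightarrow>\<^sub>L 'a" by (auto intro: blinfun_eqI)
  show ?thesis
    unfolding quadratic_matrix_def eq blinfun.sum_left blinfun_apply_blinfun_compose ..
qed

text \<open>With \<open>\<kappa>\<close> the identity or the conjugation, the root \<open>a\<close>
  for \<open>T\<close> corresponds to the root \<open>lam * \<kappa> a\<close> for \<open>U\<close>:
  shifting by these roots commutes with passing through \<open>A\<close>, up to a factor
  \<open>lam\<close>, and the products of two shifts differ by \<open>lam * lam\<close>.\<close>

lemma quadratic_matrix_similar:
  fixes A :: "'a::banach \<Rightarrow>\<^sub>L 'b::banach"
  assumes X: "scalar_field F JX" and Y: "scalar_field F JY"
    and inv: "B o\<^sub>L A = id_blinfun" "A o\<^sub>L B = id_blinfun"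
    and A: "F_linear F JX JY A \<or> F = UNIV \<and> F_conj_linear F JX JY A"
    and lam: "lam \<in> F" "lam \<noteq> 0"
    and U: "\<And>i j. i < n \<Longrightarrow> j < n \<Longrightarrow> U i j \<in> bounded_ops F JY"
      "\<And>i j. i < n \<Longrightarrow> j < n \<Longrightarrow> U i j = csmulL JY lam (A o\<^sub>L T i j o\<^sub>L B)"
  shows "quadratic_matrix F JX n T \<longleftrightarrow> quadratic_matrix F JY n U"
proof -
  interpret X: scalar_field F JX by (rule X)
  interpret Y: scalar_field F JY by (rule Y)
  obtain \<kappa> :: "complex \<Rightarrow> complex" where \<kappa>F: "\<And>c. c \<in> F \<Longrightarrow> \<kappa> c \<in> F"
    and \<kappa>\<kappa>: "\<And>c. \<kappa> (\<kappa> c) = c"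
    and A\<kappa>: "\<And>c x. c \<in> F \<Longrightarrow> A (csmul JX c x) = csmul JY (\<kappa> c) (A x)"
  proof (cases "F_linear F JX JY A")
    case True
    then show ?thesis using that[of "\<lambda>c. c"] by (simp add: F_linear_def)
  next
    case False
    then show ?thesis using that[of cnj] A by (simp add: F_conj_linear_def)
  qed
  have BA: "B (A x) = x" and AB: "A (B y) = y" for x y
    using inv by (metis blinfun_apply_blinfun_compose id_blinfun.rep_eq)+
  define E where "E a i k = T i k - (if i = k then csmulL JX a id_blinfun else 0)" for a i k
  define E' where "E' a i k = U i k - (if i = k then csmulL JY a id_blinfun else 0)" for a i k
  have E'_apply: "E' (lam * \<kappa> a) i k (A w) = csmul JY lam (A (E a i k w))"
    if "a \<in> F" "i < n" "k < n" for a i k w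
    using that lam \<kappa>F
    by (simp add: E_def E'_def U(2) blinfun.diff_left blinfun.diff_right Y.csmulL_apply X.csmulL_apply
        BA A\<kappa> Y.csmul_diff_right Y.csmul_csmul Y.csmul_0_right)
  have E'_csmul: "E' a i k (csmul JY lam w) = csmul JY lam (E' a i k w)"
    if "a \<in> F" "i < n" "k < n" for a i k w
    using that lam
    by (simp add: E'_def blinfun.diff_left Y.csmulL_apply Y.bounded_ops_csmul[OF U(1)]
        Y.csmul_diff_right Y.csmul_csmul Y.csmul_0_right mult.commute)
  have sum: "(\<Sum>k<n. E' (lam * \<kappa> a) i k (E' (lam * \<kappa> b) k j (A x)))
      = csmul JY (lam * lam) (A (\<Sum>k<n. E a i k (E b k j x)))"
    if "a \<in> F" "b \<in> F" "i < n" "j < n" for a b i j x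
    using that lam \<kappa>F
    by (simp add: E'_apply E'_csmul Y.csmul_csmul blinfun.sum_right Y.csmul_sum_right)
  have A0: "A x = 0 \<longleftrightarrow> x = 0" for x using BA[of x] by (metis blinfun.zero_right)
  have zero: "(\<forall>x. (\<Sum>k<n. E a i k (E b k j x)) = 0)
      \<longleftrightarrow> (\<forall>y. (\<Sum>k<n. E' (lam * \<kappa> a) i k (E' (lam * \<kappa> b) k j y)) = 0)"
    if "a \<in> F" "b \<in> F" "i < n" "j < n" for a b i j
  proof -
    have "(\<forall>y. (\<Sum>k<n. E' (lam * \<kappa> a) i k (E' (lam * \<kappa> b) k j y)) = 0)
        \<longleftrightarrow> (\<forall>x. (\<Sum>k<n. E' (lam * \<kappa> a) i k (E' (lam * \<kappa> b) k j (A x))) = 0)"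
      by (metis AB)
    then show ?thesis using lam by (simp add: sum that Y.csmul_eq_0 A0)
  qed
  show ?thesis
    unfolding X.quadratic_matrix_iff Y.quadratic_matrix_iff E_def[symmetric] E'_def[symmetric]
  proof safe
    fix a b assume "a \<in> F" "b \<in> F" "\<forall>i<n. \<forall>j<n. \<forall>x. (\<Sum>k<n. E a i k (E b k j x)) = 0"
    then show "\<exists>a\<in>F. \<exists>b\<in>F. \<forall>i<n. \<forall>j<n. \<forall>x. (\<Sum>k<n. E' a i k (E' b k j x)) = 0"
      using lam \<kappa>F by (intro bexI[of _ "lam * \<kappa> a"] bexI[of _ "lam * \<kappa> b"]) (simp_all add: zero[symmetric])
  next
    fix a' b' assume F: "a' \<in> F" "b' \<in> F"
      and 0: "\<forall>i<n. \<forall>j<n. \<forall>x. (\<Sum>k<n. E' a' i k (E' b' k j x)) = 0"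
    \<comment> \<open>As \<open>\<kappa>\<close> is an involution, the correspondence of roots is
      inverted by \<open>\<kappa> (c / lam)\<close>.\<close>
    have "lam * \<kappa> (\<kappa> (c / lam)) = c" for c using lam by (simp add: \<kappa>\<kappa>)
    then show "\<exists>a\<in>F. \<exists>b\<in>F. \<forall>i<n. \<forall>j<n. \<forall>x. (\<Sum>k<n. E a i k (E b k j x)) = 0"
      using lam \<kappa>F F 0
      by (intro bexI[of _ "\<kappa> (a' / lam)"] bexI[of _ "\<kappa> (b' / lam)"]) (simp_all add: zero)
  qed
qed

theorem theorem1p1:
  fixes F :: "complex set"
    and JX :: "'a::banach \<Rightarrow> 'a" and JY :: "'b::banach \<Rightarrow> 'b"
    and \<A> :: "('a \<Rightarrow>\<^sub>L 'a) set" and \<B> :: "('b \<Rightarrow>\<^sub>L 'b) set"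
    and \<phi> :: "('a \<Rightarrow>\<^sub>L 'a) \<Rightarrow> ('b \<Rightarrow>\<^sub>L 'b)"
  assumes "scalar_setting F JX JY"
    and "infinite_dimensional TYPE('a)" and "infinite_dimensional TYPE('b)"
    and "standard_operator_algebra F JX \<A>" and "standard_operator_algebra F JY \<B>"
    and "bij_betw \<phi> \<A> \<B>"
  shows "((\<forall>n. \<forall>T\<in>matrices_over n \<A>.
             quadratic_matrix F JX n T \<longleftrightarrow> quadratic_matrix F JY n (amplify \<phi> T))
          \<longleftrightarrow>
          (\<forall>T\<in>matrices_over 2 \<A>.
             quadratic_matrix F JX 2 T \<longleftrightarrow> quadratic_matrix F JY 2 (amplify \<phi> T)))
       \<and>
         ((\<forall>T\<in>matrices_over 2 \<A>.
             quadratic_matrix F JX 2 T \<longleftrightarrow> quadratic_matrix F JY 2 (amplify \<phi> T))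
          \<longleftrightarrow>
          (\<exists>A :: 'a \<Rightarrow>\<^sub>L 'b. \<exists>Ainv :: 'b \<Rightarrow>\<^sub>L 'a. \<exists>lam\<in>F.
             Ainv o\<^sub>L A = id_blinfun \<and> A o\<^sub>L Ainv = id_blinfun \<and>
             (F_linear F JX JY (blinfun_apply A) \<or>
              (F = UNIV \<and> F_conj_linear F JX JY (blinfun_apply A))) \<and>
             (\<forall>T\<in>\<A>. \<phi> T = csmulL JY lam (A o\<^sub>L T o\<^sub>L Ainv))))"
    (is "(?all \<longleftrightarrow> ?two) \<and> (?two \<longleftrightarrow> ?spatial)")
proof -
  interpret X: op_algebra F JX \<A>
    using assms(1,2,4) by unfold_locales (auto simp: scalar_setting_def)
  interpret Y: op_algebra F JY \<B>
    using assms(1,3,5) by unfold_locales (auto simp: scalar_setting_def)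
  have \<phi>: "\<phi> T \<in> \<B>" if "T \<in> \<A>" for T using assms(6) that bij_betwE by blast
  \<comment> \<open>From (2) to (3): any four elements of \<open>\<A>\<close> are the entries of a
    matrix, so the hypothesis is preservation of \<open>quad2\<close>.\<close>
  have "?spatial" if two: ?two
  proof -
    interpret quad2_preserver F JX JY \<A> \<B> \<phi>
    proof unfold_locales
      fix A B C D assume mem: "A \<in> \<A>" "B \<in> \<A>" "C \<in> \<A>" "D \<in> \<A>"
      define T where "T i j = (if i = 0 then if j = 0 then A else B else if j = 0 then C else D)" for i j :: nat
      have T: "T \<in> matrices_over 2 \<A>" using mem by (simp add: matrices_over_def T_def)
      then have bd: "T \<in> matrices_over 2 (bounded_ops F JX)" "amplify \<phi> T \<in> matrices_over 2 (bounded_ops F JY)"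
        using X.bounded_ops Y.bounded_ops \<phi> by (auto simp: matrices_over_def amplify_def)
      have "quadratic_matrix F JX 2 T \<longleftrightarrow> quadratic_matrix F JY 2 (amplify \<phi> T)" using two T by blast
      then show "quad2 F JX A B C D \<longleftrightarrow> quad2 F JY (\<phi> A) (\<phi> B) (\<phi> C) (\<phi> D)"
        unfolding X.quadratic_matrix_2[OF bd(1)] Y.quadratic_matrix_2[OF bd(2)]
        by (simp add: T_def amplify_def)
    qed (fact assms(6))
    show ?thesis by (rule spatial)
  qed
  \<comment> \<open>From (3) to (1): \<open>\<phi>\<close> acts on matrices of any size as an
    entrywise similarity times \<open>lam\<close>, where \<open>lam \<noteq> 0\<close> because
    \<open>\<phi>\<close> is injective.\<close>
  moreover have ?all if ?spatial
  proof -
    obtain A :: "'a \<Rightarrow>\<^sub>L 'b" and Ainv lam where lam: "lam \<in> F"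
      and A: "Ainv o\<^sub>L A = id_blinfun" "A o\<^sub>L Ainv = id_blinfun"
        "F_linear F JX JY A \<or> F = UNIV \<and> F_conj_linear F JX JY A"
      and eq: "\<And>T. T \<in> \<A> \<Longrightarrow> \<phi> T = csmulL JY lam (A o\<^sub>L T o\<^sub>L Ainv)"
      using \<open>?spatial\<close> by blast
    have "lam \<noteq> 0"
    proof
      assume "lam = 0"
      then have "\<phi> id_blinfun = \<phi> 0" by (simp add: eq csmulL_def)
      then have "id_blinfun = (0 :: 'a \<Rightarrow>\<^sub>L 'a)"
        using assms(6) X.id_mem X.zero_mem by (metis bij_betw_def inj_onD)
      then have "x = 0" for x :: 'a by (metis id_blinfun.rep_eq zero_blinfun.rep_eq)
      then show False using X.ex_nonzero by blast
    qed
    show ?thesis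
    proof (intro allI ballI quadratic_matrix_similar[OF X.scalar_field_axioms Y.scalar_field_axioms A lam \<open>lam \<noteq> 0\<close>])
      fix n T i j assume "T \<in> matrices_over n \<A>" "i < n" "j < n"
      then have T: "T i j \<in> \<A>" by (simp add: matrices_over_def)
      show "amplify \<phi> T i j \<in> bounded_ops F JY"
        using \<phi>[OF T] by (simp add: amplify_def Y.bounded_ops)
      show "amplify \<phi> T i j = csmulL JY lam (A o\<^sub>L T i j o\<^sub>L Ainv)"
        using eq[OF T] by (simp add: amplify_def)
    qed
  qed
  moreover have ?two if ?all using that by blast
  ultimately show ?thesis by blast
qed

end
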